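(* Let $\mathbb{K}$ be an algebraically closed field and $f_1,\ldots,f_s\in\mathbb{K}[x_1,\ldots,x_m]$ of degrees $d_1\ge\cdots\ge d_s$. Assume that the homogenizations $f_1^h,\ldots,f_s^h\in\mathbb{K}[x_1,\ldots,x_m,x_{m+1}]$ have finitely many common roots in $\mathbb{P}^m_{\mathbb{K}}$, and that none of these common roots lies at infinity (i.e. on $x_{m+1}=0$). Let $\mathcal{A}=\mathbb{K}[\mathbf{x}]/\langle f_1,\ldots,f_s\rangle$. Then: (1) If $s=m$, then $\delta=k:=\sum_{i=1}^m(d_i-1)$ satisfy condition $( * )$; moreover $\mathcal{A}$ is Gorenstein. (2) If $s>m$, then $\delta=k:=\sum_{i=1}^{m+1}d_i-m$ satisfy condition $( * )$.
   Context: $\mathbb{K}[\mathbf{x}]_k$ denotes polynomials of total degree $\le k$; $\langle f_1,\ldots,f_s\rangle_d:=\{\sum_i q_if_i:\deg q_i\le d-d_i\}$. Condition $( * )$ for integers $\delta$ and $k$ means: $\dim_{\mathbb{K}}\mathbb{K}[\mathbf{x}]_k/(\langle f_1,\ldots,f_s\rangle_\delta\cap\mathbb{K}[\mathbf{x}]_k)=\dim_{\mathbb{K}}\mathbb{K}[\mathbf{x}]_k/(\langle f_1,\ldots,f_s\rangle_d\cap\mathbb{K}[\mathbf{x}]_k)$ for all $d\ge\delta$. A finite-dimensional commutative $\mathbb{K}$-algebra $\mathcal{A}$ is Gorenstein if there is a $\mathbb{K}$-linear map $\Lambda:\mathcal{A}\to\mathbb{K}$ such that the bilinear form $(a,b)\mapsto\Lambda(ab)$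 is nondegenerate on $\mathcal{A}$. *)

theory Defs
  imports Main "HOL-Library.Poly_Mapping" "HOL-Computational_Algebra.Polynomial"
begin

text \<open>Multivariate polynomials over 'a: finitely supported maps from exponent
  vectors (nat \<Rightarrow>0 nat; variable x_(i+1) has index i) to coefficients.
  The polynomial ring K[x_1..x_m] is the set of polynomials in variables with index < m;
  the homogenizing variable x_(m+1) has index m.\<close>

type_synonym 'a mpoly = "(nat \<Rightarrow>\<^sub>0 nat) \<Rightarrow>\<^sub>0 'a"

definition mconst :: "'a::comm_ring_1 \<Rightarrow> 'a mpoly" where
  "mconst c = Poly_Mapping.single 0 c"

definition mscale :: "'a::field \<Rightarrow> 'a mpoly \<Rightarrow> 'a mpoly" where
  "mscale c p = mconst c * p"

lemma vector_space_mscale: "vector_space (mscale :: 'a::field \<Rightarrow> 'a mpoly \<Rightarrow> 'a mpoly)"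
proof
  fix a b :: 'a and x y :: "'a mpoly"
  show "mscale a (x + y) = mscale a x + mscale a y"
    unfolding mscale_def by (simp add: distrib_left)
  show "mscale (a + b) x = mscale a x + mscale b x"
    unfolding mscale_def mconst_def by (simp add: single_add distrib_right)
  have "mconst a * mconst b = mconst (a * b)"
    unfolding mconst_def by (simp add: mult_single)
  then show "mscale a (mscale b x) = mscale (a * b) x"
    unfolding mscale_def by (metis mult.assoc)
  show "mscale 1 x = x"
    unfolding mscale_def mconst_def by simp
qed

definition monom_deg :: "(nat \<Rightarrow>\<^sub>0 nat) \<Rightarrow> nat" where
  "monom_deg \<alpha> = (\<Sum>i\<in>Poly_Mapping.keys \<alpha>. Poly_Mapping.lookup \<alpha> i)"

text \<open>Total degree (the zero polynomial gets 0 by convention; it is only used for nonzero ones).\<close>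
definition mdeg :: "'a::zero mpoly \<Rightarrow> nat" where
  "mdeg p = (if p = 0 then 0 else Max (monom_deg ` Poly_Mapping.keys p))"

definition polys :: "nat \<Rightarrow> 'a::zero mpoly set" where
  "polys m = {p. \<forall>\<alpha>\<in>Poly_Mapping.keys p. Poly_Mapping.keys \<alpha> \<subseteq> {..<m}}"

text \<open>K[x]_k: polynomials of total degree \<le> k (for k < 0 only the zero polynomial).\<close>
definition polys_le :: "nat \<Rightarrow> int \<Rightarrow> 'a::zero mpoly set" where
  "polys_le m k = {p \<in> polys m. p = 0 \<or> int (mdeg p) \<le> k}"

definition trunc_ideal :: "nat \<Rightarrow> nat \<Rightarrow> (nat \<Rightarrow> 'a::comm_ring_1 mpoly) \<Rightarrow> int \<Rightarrow> 'a mpoly set" where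
  "trunc_ideal m s f d =
     {\<Sum>i<s. q i * f i | q. \<forall>i<s. q i \<in> polys_le m (d - int (mdeg (f i)))}"

definition gen_ideal :: "nat \<Rightarrow> nat \<Rightarrow> (nat \<Rightarrow> 'a::comm_ring_1 mpoly) \<Rightarrow> 'a mpoly set" where
  "gen_ideal m s f = {\<Sum>i<s. q i * f i | q. \<forall>i<s. q i \<in> polys m}"

text \<open>dim_K of U/W for subspaces W \<subseteq> U with U finite-dimensional.\<close>
definition quot_dim :: "'a::field mpoly set \<Rightarrow> 'a mpoly set \<Rightarrow> nat" where
  "quot_dim U W = vector_space.dim mscale U - vector_space.dim mscale W"

definition cond_star :: "nat \<Rightarrow> nat \<Rightarrow> (nat \<Rightarrow> 'a::field mpoly) \<Rightarrow> int \<Rightarrow> int \<Rightarrow> bool" where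
  "cond_star m s f \<delta> k \<longleftrightarrow>
     (\<forall>d\<ge>\<delta>. quot_dim (polys_le m k) (trunc_ideal m s f \<delta> \<inter> polys_le m k)
            = quot_dim (polys_le m k) (trunc_ideal m s f d \<inter> polys_le m k))"

definition meval :: "'a::comm_ring_1 mpoly \<Rightarrow> (nat \<Rightarrow> 'a) \<Rightarrow> 'a" where
  "meval p x = (\<Sum>\<alpha>\<in>Poly_Mapping.keys p. Poly_Mapping.lookup p \<alpha> * (\<Prod>i\<in>Poly_Mapping.keys \<alpha>. x i ^ Poly_Mapping.lookup \<alpha> i))"

definition homogenize :: "nat \<Rightarrow> 'a::comm_ring_1 mpoly \<Rightarrow> 'a mpoly" where
  "homogenize m p = (\<Sum>\<alpha>\<in>Poly_Mapping.keys p.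
      Poly_Mapping.single (\<alpha> + Poly_Mapping.single m (mdeg p - monom_deg \<alpha>)) (Poly_Mapping.lookup p \<alpha>))"

text \<open>Affine representatives of points of P^m: nonzero vectors (x_0..x_m) (indices \<le> m),
  coordinates with index > m being 0.\<close>
definition proj_vecs :: "nat \<Rightarrow> (nat \<Rightarrow> 'a::zero) set" where
  "proj_vecs m = {v. (\<forall>i>m. v i = 0) \<and> (\<exists>i\<le>m. v i \<noteq> 0)}"

text \<open>The point of P^m represented by v (its punctured line).\<close>
definition proj_point :: "(nat \<Rightarrow> 'a::field) \<Rightarrow> (nat \<Rightarrow> 'a) set" where
  "proj_point v = {(\<lambda>i. c * v i) | c. c \<noteq> 0}"

definition proj_common_roots :: "nat \<Rightarrow> nat \<Rightarrow> (nat \<Rightarrow> 'a::field mpoly) \<Rightarrow> (nat \<Rightarrow> 'a) set set" where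
  "proj_common_roots m s f =
     proj_point ` {v \<in> proj_vecs m. \<forall>i<s. meval (homogenize m (f i)) v = 0}"

text \<open>The quotient algebra A = K[x_1..x_m]/I is finite-dimensional and Gorenstein:
  A is spanned by finitely many classes, and there is a K-linear \<Lambda> on K[x] vanishing
  on I (i.e. a linear functional on A) whose bilinear form (a,b) \<mapsto> \<Lambda>(ab) is
  nondegenerate on A.\<close>
definition gorenstein_quotient :: "nat \<Rightarrow> 'a::field mpoly set \<Rightarrow> bool" where
  "gorenstein_quotient m I \<longleftrightarrow>
     (\<exists>B. finite B \<and> B \<subseteq> polys m \<and>
          (\<forall>p\<in>polys m. \<exists>q\<in>module.span mscale B. p - q \<in> I)) \<and>
     (\<exists>\<Lambda> :: 'a mpoly \<Rightarrow> 'a.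
        (\<forall>p\<in>polys m. \<forall>q\<in>polys m. \<Lambda> (p + q) = \<Lambda> p + \<Lambda> q) \<and>
        (\<forall>c. \<forall>p\<in>polys m. \<Lambda> (mscale c p) = c * \<Lambda> p) \<and>
        (\<forall>p\<in>I. \<Lambda> p = 0) \<and>
        (\<forall>a\<in>polys m. (\<forall>b\<in>polys m. \<Lambda> (a * b) = 0) \<longrightarrow> a \<in> I))"

end

theory Submission
  imports Defs
begin

text \<open>
  Let \<open>F\<^sub>i\<close> be the form of top degree of \<open>f\<^sub>i\<close>. Having no common root at infinity means that the \<open>F\<^sub>i\<close>
  vanish simultaneously only at the origin. Starting from the variables \<open>x\<^sub>1, \<dots>, x\<^sub>m\<close>, replace \<open>x\<^sub>j\<close>
  for \<open>j = 1, 2, \<dots>\<close> by \<open>b\<^sub>j = F\<^sub>j + \<Sum>\<^sub>l\<^sub>>\<^sub>j c\<^sup>l\<^sup>-\<^sup>j x\<^sub>j\<^bsup>d\<^sub>j-d\<^sub>l\<^esup> F\<^sub>l\<close>, where \<open>c\<close> avoids finitely many values. If \<open>C\<close>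
  is the ideal of the other \<open>m - 1\<close> elements, then the quotient by \<open>C + (x\<^sub>j)\<close> is finite-dimensional, so \<open>C\<close>
  has finitely many zeros with \<open>x\<^sub>j = 1\<close>; for generic \<open>c\<close> no such zero is a zero of \<open>b\<^sub>j\<close>, and hence a power of \<open>x\<^sub>j\<close>
  lies in \<open>C + (b\<^sub>j)\<close>. Two properties survive this exchange: homogeneous syzygies are Koszul, and
  there is a functional in degree \<open>\<sigma> = \<Sum> (deg - 1)\<close> whose pairing is nondegenerate modulo the ideal.

  Let \<open>g\<^sub>j\<close> be the same combination of the \<open>f\<^sub>l\<close>; its top form is \<open>b\<^sub>j\<close>. Koszul syzygies can be lifted
  from \<open>b\<close> to \<open>g\<close>, so every element of \<open>\<langle>g\<rangle>\<close> of degree at most \<open>k\<close> lies in \<open>\<langle>g\<rangle>\<^sub>k\<close>, and duality shows that every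
  polynomial is congruent modulo \<open>\<langle>g\<rangle>\<close> to one of degree at most \<open>\<sigma>\<close>. As the combinations are triangular,
  \<open>\<langle>f\<rangle> = \<langle>g\<rangle> + (f\<^sub>m\<^sub>+\<^sub>1, \<dots>, f\<^sub>s)\<close>; reducing the coefficients of the remaining \<open>f\<^sub>l\<close> to degree at most \<open>\<sigma>\<close> gives
  condition (*). For \<open>s = m\<close> the functional on top forms induces one on the quotient algebra, which
  is therefore Gorenstein.
\<close>

section \<open>Coefficients, scalars and termwise induction\<close>

abbreviation lkup where "lkup \<equiv> Poly_Mapping.lookup"
abbreviation mkeys where "mkeys \<equiv> Poly_Mapping.keys"

lemma lookup_mconst_mult: "lkup (mconst c * p) \<alpha> = c * lkup p \<alpha>"
proof -
  have "mconst c * p = Poly_Mapping.map ((*) c) p"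
    by (simp add: mconst_def mult_map_scale_conv_mult)
  then show ?thesis
    by (simp add: Poly_Mapping.map.rep_eq when_def)
qed

lemma mconst_0 [simp]: "mconst 0 = 0"
  and mconst_1 [simp]: "mconst 1 = 1"
  by (simp_all add: mconst_def)

lemma mconst_add: "mconst (a + b) = mconst a + mconst b"
  and mconst_mult: "mconst (a * b) = mconst a * mconst b"
  and mconst_minus: "mconst (- a) = - mconst a"
  by (simp_all add: mconst_def single_add mult_single single_uminus)

lemma mpoly_as_sum:
  fixes p :: "'b \<Rightarrow>\<^sub>0 'c::comm_monoid_add"
  shows "p = (\<Sum>\<alpha>\<in>mkeys p. Poly_Mapping.single \<alpha> (lkup p \<alpha>))"
proof (rule poly_mapping_eqI)
  fix \<beta>
  have "lkup (\<Sum>\<alpha>\<in>mkeys p. Poly_Mapping.single \<alpha> (lkup p \<alpha>)) \<beta> = (\<Sum>\<alpha>\<in>mkeys p. if \<alpha> = \<beta> then lkup p \<alpha> else 0)"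
    by (simp add: lookup_sum lookup_single when_def)
  also have "\<dots> = lkup p \<beta>"
    by (simp add: sum.delta in_keys_iff)
  finally show "lkup p \<beta> = lkup (\<Sum>\<alpha>\<in>mkeys p. Poly_Mapping.single \<alpha> (lkup p \<alpha>)) \<beta>" ..
qed

text \<open>An additive property needs checking on single terms only; carrying the set
  \<open>A\<close> along hands every bound on the support to the single-term case.\<close>

lemma mpoly_induct [consumes 1, case_names zero single add]:
  fixes p :: "'b \<Rightarrow>\<^sub>0 'c::comm_monoid_add"
  assumes "mkeys p \<subseteq> A" "P 0" "\<And>\<alpha> c. \<alpha> \<in> A \<Longrightarrow> P (Poly_Mapping.single \<alpha> c)"
    "\<And>p q. P p \<Longrightarrow> P q \<Longrightarrow> P (p + q)"
  shows "P p"
proof -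
  have "P (\<Sum>\<alpha>\<in>B. Poly_Mapping.single \<alpha> (lkup p \<alpha>))" if "finite B" "B \<subseteq> A" for B
    using that by (induction B rule: finite_induct) (auto intro: assms)
  then show ?thesis
    using assms(1) mpoly_as_sum[of p] by (metis finite_keys)
qed

subsection \<open>Polynomials with support in a given set of exponents\<close>

text \<open>Polynomials, polynomials of bounded degree and homogeneous forms all arise from this one
  notion by varying \<open>A\<close>, so the rules for sums and products are proved once.\<close>

definition supp_in :: "'b set \<Rightarrow> ('b \<Rightarrow>\<^sub>0 'c::zero) set" where
  "supp_in A = {p. mkeys p \<subseteq> A}"

lemma supp_in_0 [simp, intro]: "0 \<in> supp_in A"
  by (simp add: supp_in_def)

lemma supp_in_add [intro]: "p \<in> supp_in A \<Longrightarrow> q \<in> supp_in A \<Longrightarrow> p + q \<in> supp_in A"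
  unfolding supp_in_def using keys_add[of p q] by auto

lemma supp_in_uminus [intro]:
  fixes p :: "'b \<Rightarrow>\<^sub>0 'c::ab_group_add"
  shows "p \<in> supp_in A \<Longrightarrow> - p \<in> supp_in A"
  unfolding supp_in_def by (auto simp: in_keys_iff)

lemma supp_in_diff [intro]:
  fixes p :: "'b \<Rightarrow>\<^sub>0 'c::ab_group_add"
  shows "p \<in> supp_in A \<Longrightarrow> q \<in> supp_in A \<Longrightarrow> p - q \<in> supp_in A"
  using supp_in_add[of p A "- q"] supp_in_uminus[of q A] by simp

lemma supp_in_sum [intro]: "(\<And>i. i \<in> I \<Longrightarrow> h i \<in> supp_in A) \<Longrightarrow> (\<Sum>i\<in>I. h i) \<in> supp_in A"
  by (induction I rule: infinite_finite_induct) auto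

lemma supp_in_mono: "p \<in> supp_in A \<Longrightarrow> A \<subseteq> B \<Longrightarrow> p \<in> supp_in B"
  unfolding supp_in_def by auto

lemma supp_in_mult:
  "p \<in> supp_in A \<Longrightarrow> q \<in> supp_in B \<Longrightarrow> (\<And>\<alpha> \<beta>. \<alpha> \<in> A \<Longrightarrow> \<beta> \<in> B \<Longrightarrow> \<alpha> + \<beta> \<in> C) \<Longrightarrow> p * q \<in> supp_in C"
  unfolding supp_in_def using keys_mult[of p q] by fastforce

lemma supp_in_single [simp]: "Poly_Mapping.single \<alpha> c \<in> supp_in A \<longleftrightarrow> c = 0 \<or> \<alpha> \<in> A"
  by (auto simp: supp_in_def)

text \<open>Projection onto the terms with exponent in \<open>A\<close>; for
  \<open>A = exps_eq m d\<close> it takes the homogeneous component of degree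
  \<open>d\<close>.\<close>

lift_definition restr :: "'b set \<Rightarrow> ('b \<Rightarrow>\<^sub>0 'c::zero) \<Rightarrow> ('b \<Rightarrow>\<^sub>0 'c)" is
  "\<lambda>A p \<alpha>. p \<alpha> when \<alpha> \<in> A"
  by (rule finite_subset) auto

lemma restr_supp_in [simp, intro]: "restr A p \<in> supp_in A"
  by (auto simp: supp_in_def in_keys_iff restr.rep_eq when_def split: if_splits)

lemma diff_restr_supp_in:
  fixes p :: "'b \<Rightarrow>\<^sub>0 'c::ab_group_add"
  shows "p \<in> supp_in B \<Longrightarrow> p - restr A p \<in> supp_in (B - A)"
  by (auto simp: supp_in_def in_keys_iff restr.rep_eq lookup_minus when_def split: if_splits)

lemma restr_eq: "p \<in> supp_in A \<Longrightarrow> restr A p = p"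
  by (rule poly_mapping_eqI) (auto simp: restr.rep_eq when_def supp_in_def in_keys_iff subset_iff)

lemma restr_eq_0: "p \<in> supp_in B \<Longrightarrow> A \<inter> B = {} \<Longrightarrow> restr A p = 0"
  by (rule poly_mapping_eqI) (auto simp: restr.rep_eq when_def supp_in_def in_keys_iff subset_iff)

lemma restr_0 [simp]: "restr A 0 = 0"
  by (rule poly_mapping_eqI) (simp add: restr.rep_eq)

lemma restr_add: "restr A (p + q) = restr A p + restr A q"
  by (rule poly_mapping_eqI) (simp add: restr.rep_eq lookup_add when_def)

lemma restr_diff:
  fixes p :: "'b \<Rightarrow>\<^sub>0 'c::ab_group_add"
  shows "restr A (p - q) = restr A p - restr A q"
  by (rule poly_mapping_eqI) (simp add: restr.rep_eq lookup_minus when_def)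

lemma restr_sum: "restr A (\<Sum>i\<in>I. h i) = (\<Sum>i\<in>I. restr A (h i))"
  by (induction I rule: infinite_finite_induct) (simp_all add: restr_add)

lemma restr_mscale: "restr A (mscale c p) = mscale c (restr A p)"
  by (rule poly_mapping_eqI) (simp add: restr.rep_eq mscale_def lookup_mconst_mult when_def)

text \<open>Adding an exponent of \<open>E\<close> maps \<open>B\<close> into \<open>A\<close> and
  the complement of \<open>B\<close> into the complement of \<open>A\<close>, so projection and
  multiplication commute on single terms. The case of interest has \<open>q\<close> homogeneous and
  \<open>A\<close>, \<open>B\<close> two degree layers.\<close>

lemma restr_mult:
  fixes p q :: "'b::comm_monoid_add \<Rightarrow>\<^sub>0 'c::comm_ring_1"
  assumes "q \<in> supp_in E" and E: "\<And>\<alpha> \<beta>. \<alpha> \<in> E \<Longrightarrow> \<beta> + \<alpha> \<in> A \<longleftrightarrow> \<beta> \<in> B"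
  shows "restr A (p * q) = restr B p * q"
proof -
  have sing: "restr A (Poly_Mapping.single \<beta> b * Poly_Mapping.single \<alpha> c) =
      restr B (Poly_Mapping.single \<beta> b) * Poly_Mapping.single \<alpha> c" if "\<alpha> \<in> E" for \<alpha> \<beta> and b c :: 'c
  proof (cases "\<beta> \<in> B")
    case True
    then show ?thesis using E[OF that] by (simp add: mult_single restr_eq)
  next
    case False
    then have "restr A (Poly_Mapping.single (\<beta> + \<alpha>) (b * c)) = 0" "restr B (Poly_Mapping.single \<beta> b) = 0"
      using E[OF that, of \<beta>] by (simp_all add: restr_eq_0[where B = "{\<beta> + \<alpha>}"] restr_eq_0[where B = "{\<beta>}"])
    then show ?thesis by (simp add: mult_single)
  qed
  have *: "restr A (p * Poly_Mapping.single \<alpha> c) = restr B p * Poly_Mapping.single \<alpha> c" if "\<alpha> \<in> E" for \<alpha> and c :: 'c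
    using subset_UNIV[of "mkeys p"]
    by (induction p rule: mpoly_induct) (simp_all add: restr_add distrib_right sing that)
  have "mkeys q \<subseteq> E" using assms(1) by (simp add: supp_in_def)
  then show ?thesis
    by (induction q rule: mpoly_induct) (simp_all add: restr_add distrib_left *)
qed

subsection \<open>Exponents and forms\<close>

lemma monom_deg_superset:
  assumes "finite S" "mkeys \<alpha> \<subseteq> S"
  shows "monom_deg \<alpha> = (\<Sum>i\<in>S. lkup \<alpha> i)"
  unfolding monom_deg_def using assms by (intro sum.mono_neutral_left) (auto simp: in_keys_iff)

lemma monom_deg_add: "monom_deg (\<alpha> + \<beta>) = monom_deg \<alpha> + monom_deg \<beta>"
proof -
  let ?S = "mkeys \<alpha> \<union> mkeys \<beta>"
  have "mkeys (\<alpha> + \<beta>) \<subseteq> ?S" by (rule keys_add)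
  then show ?thesis
    by (simp add: monom_deg_superset[of ?S] lookup_add sum.distrib)
qed

lemma monom_deg_0 [simp]: "monom_deg 0 = 0"
  and monom_deg_single [simp]: "monom_deg (Poly_Mapping.single i n) = n"
  by (simp_all add: monom_deg_def)

lemma monom_deg_eq_0_iff [simp]: "monom_deg \<alpha> = 0 \<longleftrightarrow> \<alpha> = 0"
proof
  assume "monom_deg \<alpha> = 0"
  then have "lkup \<alpha> i = 0" for i by (cases "i \<in> mkeys \<alpha>") (auto simp: monom_deg_def in_keys_iff)
  then show "\<alpha> = 0" by (intro poly_mapping_eqI) simp
qed simp

lemma keys_add_nat: "mkeys (\<alpha> + \<beta> :: 'b \<Rightarrow>\<^sub>0 nat) = mkeys \<alpha> \<union> mkeys \<beta>"
  by (auto simp: in_keys_iff lookup_add)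

definition exps :: "nat \<Rightarrow> (nat \<Rightarrow>\<^sub>0 nat) set" where
  "exps m = {\<alpha>. mkeys \<alpha> \<subseteq> {..<m}}"

text \<open>Integer degrees allow a difference such as \<open>d - e i\<close> to be negative; the
  layer is then empty and its only form is zero.\<close>

definition exps_eq :: "nat \<Rightarrow> int \<Rightarrow> (nat \<Rightarrow>\<^sub>0 nat) set" where
  "exps_eq m d = {\<alpha> \<in> exps m. int (monom_deg \<alpha>) = d}"

definition exps_le :: "nat \<Rightarrow> int \<Rightarrow> (nat \<Rightarrow>\<^sub>0 nat) set" where
  "exps_le m d = {\<alpha> \<in> exps m. int (monom_deg \<alpha>) \<le> d}"

lemma exps_add: "\<alpha> + \<beta> \<in> exps m \<longleftrightarrow> \<alpha> \<in> exps m \<and> \<beta> \<in> exps m"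
  by (simp add: exps_def keys_add_nat)

lemma exps_eq_add: "\<alpha> \<in> exps_eq m d \<Longrightarrow> \<beta> \<in> exps_eq m e \<Longrightarrow> \<alpha> + \<beta> \<in> exps_eq m (d + e)"
  by (auto simp: exps_eq_def exps_add monom_deg_add)

lemma exps_le_add: "\<alpha> \<in> exps_le m d \<Longrightarrow> \<beta> \<in> exps_le m e \<Longrightarrow> \<alpha> + \<beta> \<in> exps_le m (d + e)"
  by (auto simp: exps_le_def exps_add monom_deg_add)

lemma finite_exps_le: "finite (exps_le m d)"
proof -
  have "lkup ` exps_le m d \<subseteq> {h. (\<forall>i. h i \<in> {..nat d}) \<and> (\<forall>i. i \<notin> {..<m} \<longrightarrow> h i = 0)}"
  proof clarsimp
    fix \<alpha> assume \<alpha>: "\<alpha> \<in> exps_le m d"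
    have "lkup \<alpha> i \<le> monom_deg \<alpha>" for i
      by (cases "i \<in> mkeys \<alpha>") (auto simp: monom_deg_def in_keys_iff intro: member_le_sum)
    moreover have "monom_deg \<alpha> \<le> nat d" using \<alpha> by (simp add: exps_le_def le_nat_iff)
    ultimately have "lkup \<alpha> i \<le> nat d" for i by (rule order_trans)
    then show "(\<forall>i. lkup \<alpha> i \<le> nat d) \<and> (\<forall>i. \<not> i < m \<longrightarrow> lkup \<alpha> i = 0)"
      using \<alpha> by (fastforce simp: exps_le_def exps_def in_keys_iff)
  qed
  moreover have "finite {h. (\<forall>i. h i \<in> {..nat d}) \<and> (\<forall>i. i \<notin> {..<m} \<longrightarrow> h i = (0::nat))}"
    using finite_set_of_finite_funs[of "{..<m}" "{..nat d}" 0]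
    by (rule finite_subset[rotated]) auto
  ultimately have "finite (lkup ` exps_le m d)" by (rule finite_subset)
  then show ?thesis
    by (rule finite_imageD) (simp add: inj_on_def lookup_inject)
qed

abbreviation forms :: "nat \<Rightarrow> int \<Rightarrow> 'a::zero mpoly set" where
  "forms m d \<equiv> supp_in (exps_eq m d)"

lemma polys_eq: "polys m = supp_in (exps m)"
  by (auto simp: polys_def supp_in_def exps_def)

lemma mdeg_le_iff:
  assumes "p \<noteq> 0"
  shows "mdeg p \<le> n \<longleftrightarrow> (\<forall>\<alpha>\<in>mkeys p. monom_deg \<alpha> \<le> n)"
  using assms unfolding mdeg_def by (subst if_not_P, simp, subst Max_le_iff) auto

lemma polys_le_eq: "polys_le m k = supp_in (exps_le m k)"
proof -
  have *: "int (mdeg p) \<le> k \<longleftrightarrow> (\<forall>\<alpha>\<in>mkeys p. int (monom_deg \<alpha>) \<le> k)" if p: "p \<noteq> 0" for p :: "'a mpoly"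
  proof
    assume "int (mdeg p) \<le> k"
    then show "\<forall>\<alpha>\<in>mkeys p. int (monom_deg \<alpha>) \<le> k"
      using mdeg_le_iff[OF p, of "mdeg p"] by fastforce
  next
    assume *: "\<forall>\<alpha>\<in>mkeys p. int (monom_deg \<alpha>) \<le> k"
    \<comment> \<open>A nonzero polynomial has a term, which forces \<open>k\<close> to be
      nonnegative; only then does \<open>nat k\<close> carry the bound faithfully.\<close>
    have "mkeys p \<noteq> {}" using p by simp
    then obtain \<alpha> where "\<alpha> \<in> mkeys p" by blast
    with * have "0 \<le> k" by force
    moreover from * have "\<forall>\<alpha>\<in>mkeys p. monom_deg \<alpha> \<le> nat k" by (metis nat_int nat_mono)
    then have "mdeg p \<le> nat k" using mdeg_le_iff[OF p] by blast
    ultimately show "int (mdeg p) \<le> k" by linarith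
  qed
  have "p \<in> polys_le m k \<longleftrightarrow> p \<in> supp_in (exps_le m k)" for p :: "'a mpoly"
  proof (cases "p = 0")
    case False
    then show ?thesis
      unfolding polys_le_def polys_eq supp_in_def exps_le_def using *[OF False] by blast
  qed (simp add: polys_le_def polys_eq)
  then show ?thesis by blast
qed

lemma exps_eq_le: "exps_eq m d \<subseteq> exps_le m d" and exps_le_exps: "exps_le m d \<subseteq> exps m"
  and exps_eq_exps: "exps_eq m d \<subseteq> exps m"
  by (auto simp: exps_eq_def exps_le_def)

lemma exps_le_mono: "d \<le> e \<Longrightarrow> exps_le m d \<subseteq> exps_le m e"
  by (auto simp: exps_le_def)

lemma exps_le_diff_eq: "exps_le m d - exps_eq m d = exps_le m (d - 1)"
  by (auto simp: exps_eq_def exps_le_def)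

lemma forms_mult: "p \<in> forms m d \<Longrightarrow> q \<in> forms m e \<Longrightarrow> p * q \<in> forms m (d + e)"
  by (erule (1) supp_in_mult) (rule exps_eq_add)

lemma polys_mult: "p \<in> supp_in (exps m) \<Longrightarrow> q \<in> supp_in (exps m) \<Longrightarrow> p * q \<in> supp_in (exps m)"
  by (erule (1) supp_in_mult) (simp add: exps_add)

lemma supp_le_mult:
  "p \<in> supp_in (exps_le m d) \<Longrightarrow> q \<in> supp_in (exps_le m e) \<Longrightarrow> p * q \<in> supp_in (exps_le m (d + e))"
  by (erule (1) supp_in_mult) (rule exps_le_add)

lemma forms_neg: "d < 0 \<Longrightarrow> forms m d = {0}"
  by (auto simp: supp_in_def exps_eq_def)

lemma supp_le_neg: "d < 0 \<Longrightarrow> supp_in (exps_le m d) = {0}"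
  by (auto simp: supp_in_def exps_le_def)

lemma mconst_forms [simp, intro]: "mconst c \<in> forms m 0"
  by (simp add: mconst_def exps_eq_def exps_def)

lemma one_forms [simp, intro]: "(1::'a::comm_ring_1 mpoly) \<in> forms m 0"
  using mconst_forms[of 1 m] by simp

lemma mscale_supp_in: "p \<in> supp_in A \<Longrightarrow> mscale c p \<in> supp_in A"
  by (auto simp: supp_in_def in_keys_iff mscale_def lookup_mconst_mult)

lemma forms_power:
  fixes p :: "'a::comm_ring_1 mpoly"
  shows "p \<in> forms m d \<Longrightarrow> p ^ n \<in> forms m (int n * d)"
proof (induction n)
  case (Suc n)
  then have "p * p ^ n \<in> forms m (d + int n * d)" by (intro forms_mult) auto
  then show ?case by (simp add: algebra_simps)
qed simp

lemma restr_forms_mult: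
  fixes p q :: "'a::comm_ring_1 mpoly"
  assumes "q \<in> forms m e"
  shows "restr (exps_eq m d) (p * q) = restr (exps_eq m (d - e)) p * q"
  using assms by (rule restr_mult) (auto simp: exps_eq_def exps_add monom_deg_add)

text \<open>Replacing \<open>q\<close> by its component of degree \<open>e\<close> changes the
  product only in degrees below \<open>d + e\<close>. The bounds may exceed the true degrees, in
  which case both sides vanish.\<close>

lemma top_form_mult:
  fixes p q :: "'a::comm_ring_1 mpoly"
  assumes "p \<in> supp_in (exps_le m d)" "q \<in> supp_in (exps_le m e)"
  shows "restr (exps_eq m (d + e)) (p * q) = restr (exps_eq m d) p * restr (exps_eq m e) q"
proof -
  have 1: "restr (exps_eq m (d + e)) (p * restr (exps_eq m e) q) = restr (exps_eq m d) p * restr (exps_eq m e) q"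
    using restr_forms_mult[OF restr_supp_in[of "exps_eq m e" q], of "d + e" p] by simp
  have "q - restr (exps_eq m e) q \<in> supp_in (exps_le m (e - 1))"
    using diff_restr_supp_in[OF assms(2), of "exps_eq m e"] by (simp add: exps_le_diff_eq)
  then have "p * (q - restr (exps_eq m e) q) \<in> supp_in (exps_le m (d + (e - 1)))"
    by (rule supp_le_mult[OF assms(1)])
  then have "restr (exps_eq m (d + e)) (p * (q - restr (exps_eq m e) q)) = 0"
    by (rule restr_eq_0) (auto simp: exps_eq_def exps_le_def)
  then show ?thesis using 1 by (simp add: right_diff_distrib restr_diff)
qed

definition var :: "nat \<Rightarrow> 'a::comm_ring_1 mpoly" where
  "var i = Poly_Mapping.single (Poly_Mapping.single i 1) 1"

lemma var_forms: "i < m \<Longrightarrow> var i \<in> forms m 1"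
  by (simp add: var_def exps_eq_def exps_def)

subsection \<open>Evaluation\<close>

definition mon_eval :: "(nat \<Rightarrow>\<^sub>0 nat) \<Rightarrow> (nat \<Rightarrow> 'a::comm_ring_1) \<Rightarrow> 'a" where
  "mon_eval \<alpha> x = (\<Prod>i\<in>mkeys \<alpha>. x i ^ lkup \<alpha> i)"

lemma mon_eval_superset:
  assumes "finite S" "mkeys \<alpha> \<subseteq> S"
  shows "mon_eval \<alpha> x = (\<Prod>i\<in>S. x i ^ lkup \<alpha> i)"
  unfolding mon_eval_def using assms by (intro prod.mono_neutral_left) (auto simp: in_keys_iff)

lemma mon_eval_add: "mon_eval (\<alpha> + \<beta>) x = mon_eval \<alpha> x * mon_eval \<beta> x"
proof -
  let ?S = "mkeys \<alpha> \<union> mkeys \<beta>"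
  have "mkeys (\<alpha> + \<beta>) \<subseteq> ?S" by (rule keys_add)
  then show ?thesis
    by (simp add: mon_eval_superset[of ?S] lookup_add prod.distrib power_add)
qed

lemma mon_eval_0 [simp]: "mon_eval 0 x = 1"
  and mon_eval_single [simp]: "mon_eval (Poly_Mapping.single i n) x = x i ^ n"
  by (simp_all add: mon_eval_def)

lemma meval_eq: "meval p x = (\<Sum>\<alpha>\<in>mkeys p. lkup p \<alpha> * mon_eval \<alpha> x)"
  by (simp add: meval_def mon_eval_def)

lemma meval_superset:
  assumes "finite S" "mkeys p \<subseteq> S"
  shows "meval p x = (\<Sum>\<alpha>\<in>S. lkup p \<alpha> * mon_eval \<alpha> x)"
  unfolding meval_eq using assms by (intro sum.mono_neutral_left) (auto simp: in_keys_iff)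

lemma meval_add: "meval (p + q) x = meval p x + meval q x"
proof -
  let ?S = "mkeys p \<union> mkeys q"
  have "mkeys (p + q) \<subseteq> ?S" by (rule keys_add)
  then show ?thesis
    by (simp add: meval_superset[of ?S] lookup_add sum.distrib distrib_right)
qed

lemma meval_0 [simp]: "meval 0 x = 0"
  by (simp add: meval_eq)

lemma meval_single [simp]: "meval (Poly_Mapping.single \<alpha> c) x = c * mon_eval \<alpha> x"
  by (simp add: meval_eq)

lemma meval_sum: "meval (\<Sum>i\<in>I. h i) x = (\<Sum>i\<in>I. meval (h i) x)"
  by (induction I rule: infinite_finite_induct) (simp_all add: meval_add)

lemma meval_mult: "meval (p * q) x = meval p x * meval q x"
proof -
  have 1: "meval (Poly_Mapping.single \<alpha> c * q) x = c * mon_eval \<alpha> x * meval q x" for \<alpha> c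
    using subset_UNIV[of "mkeys q"]
    by (induction q rule: mpoly_induct)
      (simp_all add: distrib_left meval_add mult_single mon_eval_add mult.assoc mult.left_commute)
  show ?thesis
    using subset_UNIV[of "mkeys p"]
    by (induction p rule: mpoly_induct) (simp_all add: distrib_right meval_add 1)
qed

lemma meval_mconst [simp]: "meval (mconst c) x = c"
  by (simp add: mconst_def)

lemma meval_var [simp]: "meval (var i) x = x i"
  by (simp add: var_def)

lemma meval_power: "meval (p ^ n) x = meval p x ^ n"
  using meval_mconst[of 1 x] by (induction n) (simp_all add: meval_mult)

subsection \<open>Graded ideals and Koszul syzygies\<close>

text \<open>The degree \<open>d\<close> part of the ideal generated by the \<open>a i\<close>,
  provided \<open>a i\<close> is homogeneous of degree \<open>e i\<close>. The degrees are given
  separately since a zero generator has none of its own.\<close>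

definition hideal :: "nat \<Rightarrow> nat set \<Rightarrow> (nat \<Rightarrow> 'a::comm_ring_1 mpoly) \<Rightarrow> (nat \<Rightarrow> int) \<Rightarrow> int \<Rightarrow> 'a mpoly set" where
  "hideal m I a e d = {\<Sum>i\<in>I. q i * a i | q. \<forall>i\<in>I. q i \<in> forms m (d - e i)}"

lemma hidealI: "u = (\<Sum>i\<in>I. q i * a i) \<Longrightarrow> (\<And>i. i \<in> I \<Longrightarrow> q i \<in> forms m (d - e i)) \<Longrightarrow> u \<in> hideal m I a e d"
  unfolding hideal_def by blast

lemma hidealE:
  assumes "u \<in> hideal m I a e d"
  obtains q where "u = (\<Sum>i\<in>I. q i * a i)" "\<And>i. i \<in> I \<Longrightarrow> q i \<in> forms m (d - e i)"
  using assms unfolding hideal_def by blast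

lemma hideal_cong:
  "(\<And>i. i \<in> I \<Longrightarrow> a i = a' i) \<Longrightarrow> (\<And>i. i \<in> I \<Longrightarrow> e i = e' i) \<Longrightarrow> hideal m I a e d = hideal m I a' e' d"
  unfolding hideal_def by (intro Collect_cong ex_cong1) (auto intro: sum.cong)

lemma hideal_0 [simp, intro]: "0 \<in> hideal m I a e d"
  by (rule hidealI[where q = "\<lambda>_. 0"]) auto

lemma hideal_add [intro]:
  assumes "u \<in> hideal m I a e d" "v \<in> hideal m I a e d"
  shows "u + v \<in> hideal m I a e d"
proof -
  obtain q where q: "u = (\<Sum>i\<in>I. q i * a i)" "\<And>i. i \<in> I \<Longrightarrow> q i \<in> forms m (d - e i)"
    using assms(1) by (rule hidealE) auto
  obtain r where r: "v = (\<Sum>i\<in>I. r i * a i)" "\<And>i. i \<in> I \<Longrightarrow> r i \<in> forms m (d - e i)"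
    using assms(2) by (rule hidealE) auto
  show ?thesis
    by (rule hidealI[where q = "\<lambda>i. q i + r i"]) (auto simp: q r distrib_right sum.distrib)
qed

lemma hideal_mult:
  assumes "u \<in> hideal m I a e d" "v \<in> forms m c"
  shows "v * u \<in> hideal m I a e (c + d)"
proof -
  obtain q where q: "u = (\<Sum>i\<in>I. q i * a i)" "\<And>i. i \<in> I \<Longrightarrow> q i \<in> forms m (d - e i)"
    using assms(1) by (rule hidealE) auto
  show ?thesis
  proof (rule hidealI[where q = "\<lambda>i. v * q i"])
    show "v * q i \<in> forms m (c + d - e i)" if "i \<in> I" for i
      using forms_mult[OF assms(2) q(2)[OF that]] by (simp add: algebra_simps)
  qed (simp add: q sum_distrib_left mult.assoc)
qed

lemma hideal_uminus [intro]: "u \<in> hideal m I a e d \<Longrightarrow> - u \<in> hideal m I a e d"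
  using hideal_mult[of u m I a e d "mconst (- 1)" 0, OF _ mconst_forms] by (simp add: mconst_minus)

lemma hideal_diff [intro]: "u \<in> hideal m I a e d \<Longrightarrow> v \<in> hideal m I a e d \<Longrightarrow> u - v \<in> hideal m I a e d"
  using hideal_add[of u m I a e d "- v"] by auto

lemma hideal_mscale: "u \<in> hideal m I a e d \<Longrightarrow> mscale c u \<in> hideal m I a e d"
  using hideal_mult[of u m I a e d "mconst c" 0] by (simp add: mscale_def)

lemma hideal_sum: "(\<And>k. k \<in> K \<Longrightarrow> h k \<in> hideal m I a e d) \<Longrightarrow> (\<Sum>k\<in>K. h k) \<in> hideal m I a e d"
  by (induction K rule: infinite_finite_induct) auto

text \<open>Singles out one generator, so that arguments can be carried out modulo the ideal of the
  others.\<close>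

lemma hideal_insert:
  assumes "finite J" "j \<notin> J"
  shows "u \<in> hideal m (insert j J) a e d \<longleftrightarrow>
    (\<exists>y\<in>hideal m J a e d. \<exists>q\<in>forms m (d - e j). u = q * a j + y)"
proof
  assume "u \<in> hideal m (insert j J) a e d"
  then show "\<exists>y\<in>hideal m J a e d. \<exists>q\<in>forms m (d - e j). u = q * a j + y"
  proof (rule hidealE)
    fix q assume q: "u = (\<Sum>i\<in>insert j J. q i * a i)" "\<And>i. i \<in> insert j J \<Longrightarrow> q i \<in> forms m (d - e i)"
    then have "(\<Sum>i\<in>J. q i * a i) \<in> hideal m J a e d" by (intro hidealI) auto
    then show ?thesis using q assms by auto
  qed
next
  assume "\<exists>y\<in>hideal m J a e d. \<exists>q\<in>forms m (d - e j). u = q * a j + y"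
  then obtain y q where u: "u = q * a j + y" and y: "y \<in> hideal m J a e d" and q: "q \<in> forms m (d - e j)"
    by blast
  obtain r where r: "y = (\<Sum>i\<in>J. r i * a i)" "\<And>i. i \<in> J \<Longrightarrow> r i \<in> forms m (d - e i)"
    using y by (rule hidealE) auto
  have "(\<Sum>i\<in>J. (r(j := q)) i * a i) = (\<Sum>i\<in>J. r i * a i)"
    using assms by (intro sum.cong) auto
  then show "u \<in> hideal m (insert j J) a e d"
    using assms by (intro hidealI[where q = "r(j := q)"]) (auto simp: u r q)
qed

lemma hideal_insertI:
  assumes "finite J" "j \<notin> J" "y \<in> hideal m J a e d" "q \<in> forms m (d - e j)"
  shows "q * a j + y \<in> hideal m (insert j J) a e d"
  unfolding hideal_insert[OF assms(1,2)] using assms by blast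

lemma hideal_insert_subset:
  assumes "finite J" "j \<notin> J" "y \<in> hideal m J a e d"
  shows "y \<in> hideal m (insert j J) a e d"
  using hideal_insertI[OF assms(1-3), of 0] by simp

text \<open>Exactness of the Koszul complex at the first syzygies: each homogeneous relation is an
  antisymmetric combination of the trivial ones. \<open>w i i = 0\<close> is a separate demand
  because antisymmetry does not imply it in characteristic two.\<close>

definition koszul :: "nat \<Rightarrow> nat set \<Rightarrow> (nat \<Rightarrow> 'a::comm_ring_1 mpoly) \<Rightarrow> (nat \<Rightarrow> int) \<Rightarrow> bool" where
  "koszul m I a e \<longleftrightarrow> (\<forall>D q. (\<forall>i\<in>I. q i \<in> forms m (D - e i)) \<and> (\<Sum>i\<in>I. q i * a i) = 0 \<longrightarrow>
     (\<exists>w. (\<forall>i\<in>I. \<forall>k\<in>I. w i k \<in> forms m (D - e i - e k) \<and> w i k = - w k i) \<and> (\<forall>i\<in>I. w i i = 0) \<and>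
          (\<forall>i\<in>I. q i = (\<Sum>k\<in>I. w i k * a k))))"

lemma koszulD:
  assumes "koszul m I a e" "\<And>i. i \<in> I \<Longrightarrow> q i \<in> forms m (D - e i)" "(\<Sum>i\<in>I. q i * a i) = 0"
  shows "\<exists>w. (\<forall>i\<in>I. \<forall>k\<in>I. w i k \<in> forms m (D - e i - e k)) \<and> (\<forall>i\<in>I. \<forall>k\<in>I. w i k = - w k i) \<and> (\<forall>i\<in>I. w i i = 0) \<and>
          (\<forall>i\<in>I. q i = (\<Sum>k\<in>I. w i k * a k))"
proof -
  have "\<exists>w. (\<forall>i\<in>I. \<forall>k\<in>I. w i k \<in> forms m (D - e i - e k) \<and> w i k = - w k i) \<and> (\<forall>i\<in>I. w i i = 0) \<and>
          (\<forall>i\<in>I. q i = (\<Sum>k\<in>I. w i k * a k))"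
    using assms unfolding koszul_def by blast
  then show ?thesis by (simp add: ball_conj_distrib)
qed

lemma koszulI:
  assumes "\<And>D q. (\<And>i. i \<in> I \<Longrightarrow> q i \<in> forms m (D - e i)) \<Longrightarrow> (\<Sum>i\<in>I. q i * a i) = 0 \<Longrightarrow>
     (\<exists>w. (\<forall>i\<in>I. \<forall>k\<in>I. w i k \<in> forms m (D - e i - e k)) \<and> (\<forall>i\<in>I. \<forall>k\<in>I. w i k = - w k i) \<and> (\<forall>i\<in>I. w i i = 0) \<and>
          (\<forall>i\<in>I. q i = (\<Sum>k\<in>I. w i k * a k)))"
  shows "koszul m I a e"
  unfolding koszul_def
proof (intro allI impI, elim conjE)
  fix D q assume "\<forall>i\<in>I. q i \<in> forms m (D - e i)" "(\<Sum>i\<in>I. q i * a i) = 0"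
  with assms[of q D] show "\<exists>w. (\<forall>i\<in>I. \<forall>k\<in>I. w i k \<in> forms m (D - e i - e k) \<and> w i k = - w k i) \<and> (\<forall>i\<in>I. w i i = 0) \<and>
          (\<forall>i\<in>I. q i = (\<Sum>k\<in>I. w i k * a k))"
    by (simp add: ball_conj_distrib)
qed

lemma koszul_cong:
  assumes K: "koszul m I a e" and a: "\<And>i. i \<in> I \<Longrightarrow> a i = a' i" and e: "\<And>i. i \<in> I \<Longrightarrow> e i = e' i"
  shows "koszul m I a' e'"
proof (rule koszulI)
  fix D q assume q: "\<And>i. i \<in> I \<Longrightarrow> q i \<in> forms m (D - e' i)" "(\<Sum>i\<in>I. q i * a' i) = 0"
  have "(\<Sum>i\<in>I. q i * a i) = 0" "\<And>i. i \<in> I \<Longrightarrow> q i \<in> forms m (D - e i)"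
    using q a e by (simp_all cong: sum.cong)
  then obtain w where w: "\<forall>i\<in>I. \<forall>k\<in>I. w i k \<in> forms m (D - e i - e k)" "\<forall>i\<in>I. \<forall>k\<in>I. w i k = - w k i"
      "\<forall>i\<in>I. w i i = 0" "\<forall>i\<in>I. q i = (\<Sum>k\<in>I. w i k * a k)"
    using koszulD[OF K, of q D] by blast
  have "(\<Sum>k\<in>I. w i k * a k) = (\<Sum>k\<in>I. w i k * a' k)" for i using a by (intro sum.cong) auto
  then have "\<forall>i\<in>I. q i = (\<Sum>k\<in>I. w i k * a' k)" using w(4) by metis
  moreover have "\<forall>i\<in>I. \<forall>k\<in>I. w i k \<in> forms m (D - e' i - e' k)" using w(1) e by metis
  ultimately show "\<exists>w. (\<forall>i\<in>I. \<forall>k\<in>I. w i k \<in> forms m (D - e' i - e' k)) \<and> (\<forall>i\<in>I. \<forall>k\<in>I. w i k = - w k i) \<and>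
      (\<forall>i\<in>I. w i i = 0) \<and> (\<forall>i\<in>I. q i = (\<Sum>k\<in>I. w i k * a' k))"
    using w(2,3) by blast
qed

section \<open>Nonzerodivisors, and removing or adjoining one generator\<close>

definition nzd :: "nat \<Rightarrow> nat set \<Rightarrow> (nat \<Rightarrow> 'a::comm_ring_1 mpoly) \<Rightarrow> (nat \<Rightarrow> int) \<Rightarrow> 'a mpoly \<Rightarrow> int \<Rightarrow> bool" where
  "nzd m J a e b c \<longleftrightarrow> (\<forall>d. \<forall>u\<in>forms m d. u * b \<in> hideal m J a e (d + c) \<longrightarrow> u \<in> hideal m J a e d)"

text \<open>A relation \<open>u * a j = (\<Sum>i\<in>J. q i * a i)\<close> is a syzygy with
  \<open>u\<close> at place \<open>j\<close>. Its Koszul form expresses \<open>u\<close> through the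
  other generators only, since the diagonal entry vanishes.\<close>

lemma koszul_nzd:
  assumes "koszul m (insert j J) a e" "finite J" "j \<notin> J"
  shows "nzd m J a e (a j) (e j)"
  unfolding nzd_def
proof (intro allI ballI impI)
  fix d u assume u: "u \<in> forms m d" and "u * a j \<in> hideal m J a e (d + e j)"
  then obtain q where q: "u * a j = (\<Sum>i\<in>J. q i * a i)" "\<And>i. i \<in> J \<Longrightarrow> q i \<in> forms m (d + e j - e i)"
    by (auto elim: hidealE)
  define q' where "q' i = (if i = j then u else - q i)" for i
  have q'j: "q' j = u" and q': "\<And>i. i \<in> J \<Longrightarrow> q' i = - q i"
    using assms(3) by (auto simp: q'_def)
  have "(\<Sum>i\<in>J. q' i * a i) = - (\<Sum>i\<in>J. q i * a i)"
    by (simp add: q' sum_negf)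
  then have sum0: "(\<Sum>i\<in>insert j J. q' i * a i) = 0"
    using assms(2,3) by (simp add: q'j q(1))
  have q'f: "q' i \<in> forms m ((d + e j) - e i)" if "i \<in> insert j J" for i
    using that q(2) u by (auto simp: q'_def)
  obtain w where w: "\<forall>i\<in>insert j J. \<forall>k\<in>insert j J. w i k \<in> forms m (d + e j - e i - e k)"
      "\<forall>i\<in>insert j J. \<forall>k\<in>insert j J. w i k = - w k i" "\<forall>i\<in>insert j J. w i i = 0"
      "\<forall>i\<in>insert j J. q' i = (\<Sum>k\<in>insert j J. w i k * a k)"
    using koszulD[OF assms(1) q'f sum0] by blast
  note w = w[rule_format]
  show "u \<in> hideal m J a e d"
  proof (rule hidealI)
    show "u = (\<Sum>k\<in>J. w j k * a k)" using w(3,4)[of j] assms(2,3) by (simp add: q'j)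
    show "w j k \<in> forms m (d - e k)" if "k \<in> J" for k
      using w(1)[of j k] that by simp
  qed
qed

text \<open>A syzygy of the smaller family, padded by 0 at \<open>j\<close>, is Koszul over the
  larger one. Row \<open>j\<close> of the resulting matrix is itself a syzygy over \<open>J\<close>,
  of degree smaller by \<open>e j\<close>, so induction on the degree makes it Koszul and lets
  column \<open>j\<close> be absorbed.\<close>

lemma koszul_remove:
  assumes K: "koszul m (insert j J) a e" and J: "finite J" "j \<notin> J" and "e j \<ge> 1" and aj: "a j \<in> forms m (e j)"
    and e: "\<And>i. i \<in> J \<Longrightarrow> e i \<ge> 0"
  shows "koszul m J a e"
proof -
  have "\<exists>w. (\<forall>i\<in>J. \<forall>k\<in>J. w i k \<in> forms m (int D - e i - e k)) \<and> (\<forall>i\<in>J. \<forall>k\<in>J. w i k = - w k i) \<and> (\<forall>i\<in>J. w i i = 0) \<and>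
          (\<forall>i\<in>J. q i = (\<Sum>k\<in>J. w i k * a k))" (is "\<exists>w. ?W D q w")
    if "\<forall>i\<in>J. q i \<in> forms m (int D - e i)" "(\<Sum>i\<in>J. q i * a i) = 0" for D q
    using that
  proof (induction D arbitrary: q rule: less_induct)
    case (less D)
    define q' where "q' = q(j := 0)"
    have q'J: "q' i = q i" if "i \<in> J" for i using that J by (auto simp: q'_def)
    have "(\<Sum>i\<in>J. q' i * a i) = (\<Sum>i\<in>J. q i * a i)"
      by (simp add: q'J)
    then have sum0: "(\<Sum>i\<in>insert j J. q' i * a i) = 0" using less.prems J by (simp add: q'_def)
    have q'f: "q' i \<in> forms m (int D - e i)" if "i \<in> insert j J" for i
      using that less.prems by (auto simp: q'_def)
    obtain w where w: "\<forall>i\<in>insert j J. \<forall>k\<in>insert j J. w i k \<in> forms m (int D - e i - e k)"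
        "\<forall>i\<in>insert j J. \<forall>k\<in>insert j J. w i k = - w k i" "\<forall>i\<in>insert j J. w i i = 0"
        "\<forall>i\<in>insert j J. q' i = (\<Sum>k\<in>insert j J. w i k * a k)"
      using koszulD[OF K q'f sum0] by blast
    note w = w[rule_format]
    have q: "q i = w i j * a j + (\<Sum>k\<in>J. w i k * a k)" if "i \<in> J" for i
      using w(4)[of i] that J by (simp add: q'J)
    have syz: "(\<Sum>k\<in>J. w j k * a k) = 0"
      using w(3,4)[of j] J by (simp add: q'_def)
    have "\<exists>v. (\<forall>i\<in>J. \<forall>k\<in>J. v i k \<in> forms m (int D - e j - e i - e k)) \<and> (\<forall>i\<in>J. \<forall>k\<in>J. v i k = - v k i) \<and> (\<forall>i\<in>J. v i i = 0) \<and>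
          (\<forall>i\<in>J. w j i = (\<Sum>k\<in>J. v i k * a k))"
    \<comment> \<open>Below degree zero every form is zero, which grounds the induction.\<close>
    proof (cases "int D - e j < 0")
      case True
      then have "w j i = 0" if "i \<in> J" for i
        using w(1)[of j i] e[OF that] that forms_neg[of "int D - e j - e i" m] by auto
      then show ?thesis by (intro exI[of _ "\<lambda>_ _. 0"]) auto
    next
      case False
      then obtain D' where D': "int D - e j = int D'" by (metis nonneg_int_cases not_less)
      have "\<exists>v. ?W D' (w j) v"
      proof (rule less.IH)
        show "D' < D" using D' \<open>e j \<ge> 1\<close> by linarith
        show "\<forall>i\<in>J. w j i \<in> forms m (int D' - e i)" using w(1)[of j] D' by simp
      qed (rule syz)
      then show ?thesis using D' by simp
    qed
    then obtain v where v: "\<forall>i\<in>J. \<forall>k\<in>J. v i k \<in> forms m (int D - e j - e i - e k)" "\<forall>i\<in>J. \<forall>k\<in>J. v i k = - v k i"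
        "\<forall>i\<in>J. v i i = 0" "\<forall>i\<in>J. w j i = (\<Sum>k\<in>J. v i k * a k)"
      by blast
    have vaj: "v i k * a j \<in> forms m (int D - e i - e k)" if "i \<in> J" "k \<in> J" for i k
      using forms_mult[OF v(1)[rule_format, OF that(1,2)] aj] by (simp add: algebra_simps)
    \<comment> \<open>By antisymmetry \<open>w i j\<close> equals \<open>- w j i\<close>, and
      \<open>v\<close> rewrites \<open>w j i\<close> over \<open>J\<close>; subtracting
      \<open>v i k * a j\<close> thus absorbs the term with \<open>a j\<close> and keeps the matrix
      antisymmetric.\<close>
    show ?case
    proof (intro exI[of _ "\<lambda>i k. w i k - v i k * a j"] conjI ballI)
      fix i assume i: "i \<in> J"
      show "w i i - v i i * a j = 0" using i w(3) v(3) by simp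
      have wij: "w i j = - w j i" using w(2) i by blast
      show "q i = (\<Sum>k\<in>J. (w i k - v i k * a j) * a k)"
        using q[OF i] v(4) i unfolding wij
        by (simp add: algebra_simps sum_subtractf sum_distrib_left)
    next
      fix i k assume ik: "i \<in> J" "k \<in> J"
      have "w i k = - w k i" "v i k = - v k i" using w(2) v(2) ik by blast+
      then show "w i k - v i k * a j = - (w k i - v k i * a j)" by (simp add: algebra_simps)
      show "w i k - v i k * a j \<in> forms m (int D - e i - e k)"
        using w(1)[of i k] ik vaj by (intro supp_in_diff) auto
    qed
  qed
  note main = this
  show ?thesis
  proof (rule koszulI)
    fix D q assume q: "\<And>i. i \<in> J \<Longrightarrow> q i \<in> forms m (D - e i)" "(\<Sum>i\<in>J. q i * a i) = 0"
    show "\<exists>w. (\<forall>i\<in>J. \<forall>k\<in>J. w i k \<in> forms m (D - e i - e k)) \<and> (\<forall>i\<in>J. \<forall>k\<in>J. w i k = - w k i) \<and> (\<forall>i\<in>J. w i i = 0) \<and>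
          (\<forall>i\<in>J. q i = (\<Sum>k\<in>J. w i k * a k))"
    proof (cases "D < 0")
      case True
      then have "q i = 0" if "i \<in> J" for i
        using q(1)[OF that] e[OF that] forms_neg[of "D - e i" m] by auto
      then show ?thesis by (intro exI[of _ "\<lambda>_ _. 0"]) auto
    next
      case False
      then have D: "int (nat D) = D" by simp
      show ?thesis using main[of q "nat D", unfolded D] q by blast
    qed
  qed
qed

text \<open>Cancelling \<open>a j\<close> shows that \<open>q j\<close> lies in the ideal of the
  others; subtracting the corresponding trivial relations between \<open>j\<close> and
  \<open>J\<close> leaves a syzygy over \<open>J\<close>, which is Koszul.\<close>

lemma koszul_insert:
  assumes K: "koszul m J a e" and J: "finite J" "j \<notin> J" and b: "a j \<in> forms m (e j)"
    and nzd: "nzd m J a e (a j) (e j)"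
  shows "koszul m (insert j J) a e"
proof (rule koszulI)
  fix D q assume q: "\<And>i. i \<in> insert j J \<Longrightarrow> q i \<in> forms m (D - e i)" "(\<Sum>i\<in>insert j J. q i * a i) = 0"
  have "q j * a j = (\<Sum>i\<in>J. (- q i) * a i)"
    using q(2) J by (simp add: sum_negf eq_neg_iff_add_eq_0)
  then have "q j * a j \<in> hideal m J a e D"
    using q(1) by (intro hidealI[where q = "\<lambda>i. - q i"]) auto
  then have "q j \<in> hideal m J a e (D - e j)"
    using nzd q(1)[of j] unfolding nzd_def by (metis diff_add_cancel insertI1)
  then obtain p where p: "q j = (\<Sum>i\<in>J. p i * a i)" "\<And>i. i \<in> J \<Longrightarrow> p i \<in> forms m (D - e j - e i)"
    by (auto elim: hidealE)
  have sum0: "(\<Sum>i\<in>J. (q i + p i * a j) * a i) = 0"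
  proof -
    have "(\<Sum>i\<in>J. (q i + p i * a j) * a i) = (\<Sum>i\<in>J. q i * a i) + q j * a j"
      by (simp add: p(1) distrib_right sum.distrib sum_distrib_right sum_distrib_left distrib_left ac_simps)
    then show ?thesis using q(2) J by (simp add: add.commute)
  qed
  have qf: "q i + p i * a j \<in> forms m (D - e i)" if "i \<in> J" for i
    using forms_mult[OF p(2)[OF that] b] q(1)[of i] that by (intro supp_in_add) (auto simp: algebra_simps)
  obtain v where v: "\<forall>i\<in>J. \<forall>k\<in>J. v i k \<in> forms m (D - e i - e k)"
      "\<forall>i\<in>J. \<forall>k\<in>J. v i k = - v k i" "\<forall>i\<in>J. v i i = 0"
      "\<forall>i\<in>J. q i + p i * a j = (\<Sum>k\<in>J. v i k * a k)"
    using koszulD[OF K qf sum0] by blast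
  note v = v[rule_format]
  \<comment> \<open>The bordered matrix: \<open>p\<close> in row \<open>j\<close>,
    \<open>- p\<close> in column \<open>j\<close>, and \<open>v\<close> as the block over
    \<open>J\<close>.\<close>
  define w where "w i k = (if i = j then if k = j then 0 else p k else if k = j then - p i else v i k)" for i k
  have ne: "i \<noteq> j" if "i \<in> J" for i using that J by auto
  have w: "w j j = 0" "\<And>k. k \<in> J \<Longrightarrow> w j k = p k" "\<And>i. i \<in> J \<Longrightarrow> w i j = - p i"
    "\<And>i k. i \<in> J \<Longrightarrow> k \<in> J \<Longrightarrow> w i k = v i k"
    using ne by (auto simp: w_def)
  show "\<exists>w. (\<forall>i\<in>insert j J. \<forall>k\<in>insert j J. w i k \<in> forms m (D - e i - e k)) \<and>
      (\<forall>i\<in>insert j J. \<forall>k\<in>insert j J. w i k = - w k i) \<and> (\<forall>i\<in>insert j J. w i i = 0) \<and>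
      (\<forall>i\<in>insert j J. q i = (\<Sum>k\<in>insert j J. w i k * a k))"
  proof (intro exI[of _ w] conjI)
    show "\<forall>i\<in>insert j J. \<forall>k\<in>insert j J. w i k \<in> forms m (D - e i - e k)"
      using p(2) v(1) by (auto simp: w algebra_simps intro!: supp_in_uminus)
    show "\<forall>i\<in>insert j J. \<forall>k\<in>insert j J. w i k = - w k i"
    proof (intro ballI)
      fix i k assume "i \<in> insert j J" "k \<in> insert j J"
      then consider "i = j" "k = j" | "i = j" "k \<in> J" | "i \<in> J" "k = j" | "i \<in> J" "k \<in> J" by blast
      then show "w i k = - w k i" by cases (use v(2)[of i k] in \<open>simp_all add: w\<close>)
    qed
    show "\<forall>i\<in>insert j J. w i i = 0" using v(3) by (auto simp: w)
    have "q i = (\<Sum>k\<in>J. v i k * a k) - p i * a j" if "i \<in> J" for i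
      using v(4)[OF that] by (simp add: algebra_simps)
    then show "\<forall>i\<in>insert j J. q i = (\<Sum>k\<in>insert j J. w i k * a k)"
      using p(1) J by (auto simp: w)
  qed
qed

subsection \<open>Dualizing functionals and the exchange of one element\<close>

definition islin :: "('a::field mpoly \<Rightarrow> 'a) \<Rightarrow> bool" where
  "islin \<phi> \<longleftrightarrow> (\<forall>x y. \<phi> (x + y) = \<phi> x + \<phi> y) \<and> (\<forall>c x. \<phi> (mscale c x) = c * \<phi> x)"

lemma islin_0: "islin \<phi> \<Longrightarrow> \<phi> 0 = 0"
  unfolding islin_def by (metis add.right_neutral add_left_cancel)

lemma islin_add: "islin \<phi> \<Longrightarrow> \<phi> (x + y) = \<phi> x + \<phi> y"
  and islin_mscale: "islin \<phi> \<Longrightarrow> \<phi> (mscale c x) = c * \<phi> x"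
  unfolding islin_def by blast+

lemma islin_diff: "islin \<phi> \<Longrightarrow> \<phi> (x - y) = \<phi> x - \<phi> y"
  using islin_add[of \<phi> "x - y" y] by simp

text \<open>A basis of \<open>S\<close> carries the values of \<phi>, and the linear map constructed
  from them is defined on all polynomials.\<close>

lemma islin_extend:
  assumes 0: "0 \<in> S" and add: "\<And>x y. x \<in> S \<Longrightarrow> y \<in> S \<Longrightarrow> x + y \<in> S"
    and scale: "\<And>c x. x \<in> S \<Longrightarrow> mscale c x \<in> S"
    and \<phi>_add: "\<And>x y. x \<in> S \<Longrightarrow> y \<in> S \<Longrightarrow> \<phi> (x + y) = \<phi> x + \<phi> y"
    and \<phi>_scale: "\<And>c x. x \<in> S \<Longrightarrow> \<phi> (mscale c x) = c * \<phi> x"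
  shows "\<exists>\<psi>. islin \<psi> \<and> (\<forall>x\<in>S. \<psi> x = \<phi> x)"
proof -
  interpret vs: vector_space "mscale :: 'a \<Rightarrow> 'a mpoly \<Rightarrow> 'a mpoly"
    by (rule vector_space_mscale)
  interpret vp: vector_space_pair "mscale :: 'a \<Rightarrow> 'a mpoly \<Rightarrow> 'a mpoly" "(*) :: 'a \<Rightarrow> 'a \<Rightarrow> 'a"
    by unfold_locales (simp_all add: algebra_simps)
  obtain B where B: "B \<subseteq> S" "vs.independent B" "S \<subseteq> vs.span B"
    using vs.maximal_independent_subset[of S] by blast
  define \<psi> where "\<psi> = vp.construct B \<phi>"
  have "Vector_Spaces.linear mscale (*) \<psi>"
    unfolding \<psi>_def by (rule vp.linear_construct[OF B(2)])
  then have lin: "islin \<psi>"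
    unfolding islin_def Vector_Spaces.linear_iff by blast
  have \<phi>0: "\<phi> 0 = 0" using \<phi>_add[OF 0 0] by (metis add.right_neutral add_left_cancel)
  \<comment> \<open>Membership in \<open>S\<close> is proved along with the equality, because \<phi>
    is known to be additive on \<open>S\<close> only.\<close>
  have "x \<in> S \<and> \<psi> x = \<phi> x" if "x \<in> vs.span B" for x
    using that
  proof (induction rule: vs.span_induct_alt)
    case base
    then show ?case using 0 \<phi>0 islin_0[OF lin] by simp
  next
    case (step c x y)
    then have "x \<in> S" "\<psi> x = \<phi> x" using B by (auto simp: \<psi>_def vp.construct_basis[OF B(2)])
    with step show ?case
      by (simp add: add scale \<phi>_add \<phi>_scale islin_add[OF lin] islin_mscale[OF lin])
  qed
  then show ?thesis using lin B(3) by blast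
qed

text \<open>Graded Gorenstein duality with socle degree \<sigma>: the kernel of the pairing between
  degrees \<open>d\<close> and \<open>\<sigma> - d\<close> is exactly the ideal in degree
  \<open>d\<close>.\<close>

definition dualizing :: "nat \<Rightarrow> nat set \<Rightarrow> (nat \<Rightarrow> 'a::field mpoly) \<Rightarrow> (nat \<Rightarrow> int) \<Rightarrow> int \<Rightarrow> ('a mpoly \<Rightarrow> 'a) \<Rightarrow> bool" where
  "dualizing m I a e \<sigma> \<phi> \<longleftrightarrow> islin \<phi> \<and> (\<forall>u\<in>hideal m I a e \<sigma>. \<phi> u = 0) \<and>
     (\<forall>d. \<forall>u\<in>forms m d. (\<forall>v\<in>forms m (\<sigma> - d). \<phi> (u * v) = 0) \<longrightarrow> u \<in> hideal m I a e d)"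

text \<open>Above \<sigma> the complementary degree is negative, so orthogonality is trivial and
  duality puts every form into the ideal.\<close>

lemma dualizing_high_degree:
  assumes "dualizing m I a e \<sigma> \<phi>" "d > \<sigma>" "u \<in> forms m d"
  shows "u \<in> hideal m I a e d"
proof -
  have "forms m (\<sigma> - d) = ({0} :: 'a mpoly set)" using assms(2) by (intro forms_neg) simp
  then show ?thesis using assms islin_0[of \<phi>] unfolding dualizing_def by auto
qed

lemma nzd_power:
  assumes nzd: "nzd m J a e b c" and b: "b \<in> forms m c"
    and "u \<in> forms m d" "u * b ^ k \<in> hideal m J a e (d + int k * c)"
  shows "u \<in> hideal m J a e d"
  using assms(3,4)
proof (induction k arbitrary: u d)
  case (Suc k)
  have ub: "u * b \<in> forms m (d + c)" using Suc.prems b by (intro forms_mult)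
  have "u * b * b ^ k \<in> hideal m J a e (d + c + int k * c)"
    using Suc.prems(2) by (simp add: algebra_simps)
  with Suc.IH[OF ub] have "u * b \<in> hideal m J a e (d + c)" by blast
  then show ?case using nzd Suc.prems(1) unfolding nzd_def by blast
qed simp

text \<open>A functional for \<open>(c, x)\<close> is transported along multiplication by \<open>x\<^sup>k\<close>, which is injective modulo
  \<open>c\<close>, and then extended arbitrarily; the result is a functional for \<open>(c, x\<^sup>k\<^sup>+\<^sup>1)\<close>.\<close>
lemma dual_power:
  assumes J: "finite J" "j \<notin> J" and nzd: "nzd m J a e (a j) (e j)"
    and aj: "a j \<in> forms m (e j)" and dual: "dualizing m (insert j J) a e \<sigma> \<phi>"
  obtains \<psi> where "islin \<psi>" "\<And>y. y \<in> hideal m J a e (\<sigma> + int k * e j) \<Longrightarrow> \<psi> y = 0"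
    "\<And>q. q \<in> forms m (\<sigma> - e j) \<Longrightarrow> \<psi> (q * a j ^ Suc k) = 0"
    "\<And>d u. u \<in> forms m d \<Longrightarrow> (\<And>v. v \<in> forms m (\<sigma> + int k * e j - d) \<Longrightarrow> \<psi> (u * v) = 0) \<Longrightarrow>
       \<exists>q\<in>forms m (d - int (Suc k) * e j). \<exists>y\<in>hideal m J a e d. u = q * a j ^ Suc k + y"
proof -
  let ?C = "hideal m J a e"
  define x where "x = a j"
  define s where "s = \<sigma> + int k * e j"
  have lin: "islin \<phi>" using dual by (simp add: dualizing_def)
  have van: "\<phi> u = 0" if "u \<in> hideal m (insert j J) a e \<sigma>" for u
    using dual that by (simp add: dualizing_def)
  have vanC: "\<phi> u = 0" if "u \<in> ?C \<sigma>" for u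
    using van hideal_insert_subset[OF J that] by blast
  \<comment> \<open>\<open>R z u\<close> says that \<open>z\<close> is congruent to
    \<open>u * x ^ k\<close> modulo the ideal of \<open>J\<close>; the new functional is to take the
    value \<open>\<phi> u\<close> at such \<open>z\<close>.\<close>
  define R where "R z u \<longleftrightarrow> u \<in> forms m \<sigma> \<and> z - u * x ^ k \<in> ?C s" for z u
  have uniq: "\<phi> u = \<phi> u'" if "R z u" "R z u'" for z u u'
  proof -
    have "(z - u' * x ^ k) - (z - u * x ^ k) \<in> ?C s" using that unfolding R_def by (metis hideal_diff)
    then have "(u - u') * x ^ k \<in> ?C (\<sigma> + int k * e j)" by (simp add: algebra_simps s_def)
    moreover have "u - u' \<in> forms m \<sigma>" using that unfolding R_def by (intro supp_in_diff) auto
    ultimately have "u - u' \<in> ?C \<sigma>" using nzd_power[OF nzd aj] unfolding x_def by blast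
    then show ?thesis using vanC islin_diff[OF lin, of u u'] by simp
  qed
  \<comment> \<open>The choice of \<open>u\<close> does not matter: two candidates differ by an
    element of the ideal of \<open>J\<close>, where \<phi> vanishes.\<close>
  define \<psi>0 where "\<psi>0 z = \<phi> (SOME u. R z u)" for z
  have \<psi>0: "\<psi>0 z = \<phi> u" if "R z u" for z u
    unfolding \<psi>0_def using that uniq by (metis someI_ex)
  define S where "S = {z. \<exists>u. R z u}"
  have R_add: "R (z + z') (u + u')" if "R z u" "R z' u'" for z z' u u'
  proof -
    have "(z - u * x ^ k) + (z' - u' * x ^ k) \<in> ?C s" using that unfolding R_def by blast
    then show ?thesis using that unfolding R_def by (auto simp: algebra_simps)
  qed
  have R_scale: "R (mscale c z) (mscale c u)" if "R z u" for z u c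
  proof -
    have "mscale c (z - u * x ^ k) \<in> ?C s" using that unfolding R_def by (intro hideal_mscale) auto
    moreover have "mscale c (z - u * x ^ k) = mscale c z - mscale c u * x ^ k"
      by (simp add: mscale_def right_diff_distrib mult.assoc)
    ultimately show ?thesis using that unfolding R_def by (auto intro: mscale_supp_in)
  qed
  have "\<exists>\<psi>. islin \<psi> \<and> (\<forall>z\<in>S. \<psi> z = \<psi>0 z)"
  proof (rule islin_extend)
    have "R 0 0" by (auto simp: R_def)
    then show "0 \<in> S" by (auto simp: S_def)
  next
    fix y z assume "y \<in> S" "z \<in> S"
    then obtain u v where uv: "R y u" "R z v" by (auto simp: S_def)
    then show "y + z \<in> S" using R_add[of y u z v] by (auto simp: S_def)
    show "\<psi>0 (y + z) = \<psi>0 y + \<psi>0 z"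
      using \<psi>0[OF R_add[OF uv]] \<psi>0[OF uv(1)] \<psi>0[OF uv(2)] islin_add[OF lin] by simp
  next
    fix c z assume "z \<in> S"
    then obtain u where u: "R z u" by (auto simp: S_def)
    then show "mscale c z \<in> S" using R_scale[of z u c] by (auto simp: S_def)
    show "\<psi>0 (mscale c z) = c * \<psi>0 z"
      using \<psi>0[OF R_scale[OF u]] \<psi>0[OF u] islin_mscale[OF lin] by simp
  qed
  then obtain \<psi> where \<psi>: "islin \<psi>" "\<And>z. z \<in> S \<Longrightarrow> \<psi> z = \<psi>0 z" by blast
  have \<psi>R: "\<psi> z = \<phi> u" if "R z u" for z u
    using \<psi>(2)[of z] \<psi>0[OF that] that by (auto simp: S_def)
  have \<psi>pow: "\<psi> (u * x ^ k) = \<phi> u" if "u \<in> forms m \<sigma>" for u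
    using that by (intro \<psi>R) (auto simp: R_def)
  show ?thesis
  proof (rule that)
    show "islin \<psi>" by (rule \<psi>)
    show van\<psi>: "\<psi> y = 0" if "y \<in> hideal m J a e (\<sigma> + int k * e j)" for y
      using \<psi>R[of y 0] that islin_0[OF lin] by (simp add: R_def s_def)
    show "\<psi> (q * a j ^ Suc k) = 0" if "q \<in> forms m (\<sigma> - e j)" for q
    proof -
      have "q * a j \<in> forms m \<sigma>" using forms_mult[OF that aj] by simp
      moreover have "q * a j \<in> hideal m (insert j J) a e \<sigma>"
        using hideal_insertI[OF J, of 0 m a e \<sigma> q] that by simp
      ultimately show ?thesis using \<psi>pow[of "q * a j"] van by (simp add: x_def mult_ac)
    qed
    fix d u assume u: "u \<in> forms m d"
      and orth: "\<And>v. v \<in> forms m (\<sigma> + int k * e j - d) \<Longrightarrow> \<psi> (u * v) = 0"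
    \<comment> \<open>Factors \<open>a j\<close> are split off one at a time: if
      \<open>u = q * a j ^ l + y\<close>, testing \<open>u\<close> against
      \<open>v * a j ^ (k - l)\<close> gives \<open>\<phi> (q * v) = 0\<close>, so duality puts
      \<open>q\<close> into the ideal with \<open>a j\<close>. The last step has
      \<open>l = k\<close>, hence the bound \<open>Suc k\<close>.\<close>
    have "\<exists>q\<in>forms m (d - int l * e j). \<exists>y\<in>?C d. u = q * a j ^ l + y" if "l \<le> Suc k" for l
      using that
    proof (induction l)
      case 0
      then show ?case using u by (intro bexI[of _ u] bexI[of _ 0]) auto
    next
      case (Suc l)
      then obtain q y where q: "q \<in> forms m (d - int l * e j)" and y: "y \<in> ?C d" and uq: "u = q * a j ^ l + y"
        by auto
      let ?d = "d - int l * e j"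
      have "\<phi> (q * v) = 0" if v: "v \<in> forms m (\<sigma> - ?d)" for v
      proof -
        let ?v = "v * a j ^ (k - l)"
        have kl: "int (k - l) = int k - int l" using Suc.prems by simp
        have "?v \<in> forms m (\<sigma> - ?d + int (k - l) * e j)"
          by (intro forms_mult v forms_power aj)
        then have v': "?v \<in> forms m (s - d)" by (simp add: s_def kl algebra_simps)
        have "y * ?v \<in> ?C s" using hideal_mult[OF y v'] by (simp add: mult.commute)
        then have "\<psi> (y * ?v) = 0" using van\<psi> by (simp add: s_def)
        moreover have "u * ?v = (q * v) * a j ^ k + y * ?v"
        proof -
          have "a j ^ k = a j ^ l * a j ^ (k - l)"
            using Suc.prems by (simp flip: power_add)
          then show ?thesis by (simp add: uq algebra_simps)
        qed
        moreover have "\<psi> (u * ?v) = 0" using orth v' by (simp add: s_def)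
        ultimately have "\<psi> ((q * v) * x ^ k) = 0" using islin_add[OF \<psi>(1)] by (simp add: x_def)
        moreover have "q * v \<in> forms m \<sigma>" using forms_mult[OF q v] by simp
        ultimately show ?thesis using \<psi>pow by simp
      qed
      then have "q \<in> hideal m (insert j J) a e ?d"
        using dual q unfolding dualizing_def by blast
      then obtain r z where r: "r \<in> forms m (?d - e j)" and z: "z \<in> ?C ?d" and qr: "q = r * a j + z"
        unfolding hideal_insert[OF J] by blast
      have "u = r * a j ^ Suc l + (a j ^ l * z + y)" by (simp add: uq qr algebra_simps)
      moreover have "a j ^ l * z \<in> ?C d"
        using hideal_mult[OF z forms_power[OF aj, of l]] by simp
      then have "a j ^ l * z + y \<in> ?C d" using y by blast
      moreover have "r \<in> forms m (d - int (Suc l) * e j)" using r by (simp add: algebra_simps)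
      ultimately show ?case by blast
    qed
    then show "\<exists>q\<in>forms m (d - int (Suc k) * e j). \<exists>y\<in>?C d. u = q * a j ^ Suc k + y" by blast
  qed
qed

text \<open>Write the power of \<open>a j\<close> as \<open>w * b + z\<close> with \<open>z\<close>
  in the ideal \<open>C\<close> of \<open>J\<close>. Modulo \<open>C\<close>, multiplication by
  \<open>b\<close> is then injective because multiplication by \<open>a j\<close> is. For duality,
  linkage applies: the ideal of \<open>C\<close> and \<open>b\<close> is the colon ideal by
  \<open>w\<close> of the ideal of \<open>C\<close> and \<open>a j ^ Suc k\<close>, so the new
  functional is \<open>u \<mapsto> \<psi> (w * u)\<close>; the degree of \<open>w\<close> explains
  the shift to \<open>\<sigma> - e j + c\<close>.\<close>

lemma exchange:
  fixes a :: "nat \<Rightarrow> 'a::field mpoly"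
  assumes J: "finite J" "j \<notin> J" and K: "koszul m (insert j J) a e"
    and e: "e j \<ge> 1" "\<And>i. i \<in> J \<Longrightarrow> e i \<ge> 0"
    and a: "\<And>i. i \<in> insert j J \<Longrightarrow> a i \<in> forms m (e i)"
    and dual: "dualizing m (insert j J) a e \<sigma> \<phi>" and b: "b \<in> forms m c"
    and pow: "a j ^ Suc k \<in> hideal m (insert j J) (a(j := b)) (e(j := c)) (int (Suc k) * e j)"
  shows "koszul m (insert j J) (a(j := b)) (e(j := c))"
    and "\<exists>\<psi>. dualizing m (insert j J) (a(j := b)) (e(j := c)) (\<sigma> - e j + c) \<psi>"
proof -
  let ?C = "hideal m J a e"
  let ?N = "int (Suc k) * e j"
  have C: "hideal m J (a(j := b)) (e(j := c)) = ?C"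
    using J by (intro ext hideal_cong) auto
  have aj: "a j \<in> forms m (e j)" using a by blast
  have nzda: "nzd m J a e (a j) (e j)" by (rule koszul_nzd[OF K J])
  have KJ: "koszul m J a e" by (rule koszul_remove[OF K J e(1) aj e(2)])
  obtain w z where w: "w \<in> forms m (?N - c)" and z: "z \<in> ?C ?N" and wz: "a j ^ Suc k = w * b + z"
    using pow unfolding hideal_insert[OF J] C by auto
  \<comment> \<open>Since \<open>w * b\<close> and \<open>a j ^ Suc k\<close> agree modulo
    \<open>?C\<close>, cancelling \<open>w * b\<close> amounts to cancelling powers of
    \<open>a j\<close>.\<close>
  have key: "u \<in> ?C d" if "u \<in> forms m d" "u * (w * b) \<in> ?C (d + ?N)" for u d
  proof -
    have "u * z \<in> ?C (d + ?N)" by (rule hideal_mult[OF z that(1)])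
    then have "u * (w * b) + u * z \<in> ?C (d + ?N)" using that by blast
    then have "u * a j ^ Suc k \<in> ?C (d + int (Suc k) * e j)" unfolding wz by (simp add: distrib_left)
    then show ?thesis by (rule nzd_power[OF nzda aj that(1)])
  qed
  have nzdb: "nzd m J a e b c"
    unfolding nzd_def
  proof (intro allI ballI impI)
    fix d u assume u: "u \<in> forms m d" "u * b \<in> ?C (d + c)"
    have "w * (u * b) \<in> ?C (d + ?N)"
      using hideal_mult[OF u(2) w] by (simp add: algebra_simps)
    then show "u \<in> ?C d" using key[OF u(1)] by (simp add: mult_ac)
  qed
  show "koszul m (insert j J) (a(j := b)) (e(j := c))"
  proof (rule koszul_insert[OF _ J])
    show "koszul m J (a(j := b)) (e(j := c))"
      using J by (intro koszul_cong[OF KJ]) auto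
    show "nzd m J (a(j := b)) (e(j := c)) ((a(j := b)) j) ((e(j := c)) j)"
      using nzdb unfolding nzd_def C by simp
  qed (use b in simp)
  obtain \<psi> where lin: "islin \<psi>" and \<psi>C: "\<And>y. y \<in> ?C (\<sigma> + int k * e j) \<Longrightarrow> \<psi> y = 0"
    and \<psi>p: "\<And>q. q \<in> forms m (\<sigma> - e j) \<Longrightarrow> \<psi> (q * a j ^ Suc k) = 0"
    and \<psi>d: "\<And>d u. u \<in> forms m d \<Longrightarrow> (\<And>v. v \<in> forms m (\<sigma> + int k * e j - d) \<Longrightarrow> \<psi> (u * v) = 0) \<Longrightarrow>
       \<exists>q\<in>forms m (d - int (Suc k) * e j). \<exists>y\<in>?C d. u = q * a j ^ Suc k + y"
    using dual_power[OF J nzda aj dual, of k thesis] by blast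
  let ?s = "\<sigma> - e j + c"
  have deg: "?N - c + ?s = \<sigma> + int k * e j" by (simp add: algebra_simps)
  have "dualizing m (insert j J) (a(j := b)) (e(j := c)) ?s (\<lambda>u. \<psi> (w * u))"
    unfolding dualizing_def
  proof (intro conjI ballI allI impI)
    show "islin (\<lambda>u. \<psi> (w * u))"
    proof -
      have "w * mscale c x = mscale c (w * x)" for c x by (simp add: mscale_def mult.left_commute)
      then show ?thesis using lin unfolding islin_def by (simp add: distrib_left)
    qed
  next
    fix u assume "u \<in> hideal m (insert j J) (a(j := b)) (e(j := c)) ?s"
    then obtain q y where q: "q \<in> forms m (?s - c)" and y: "y \<in> ?C ?s" and u: "u = q * b + y"
      unfolding hideal_insert[OF J] C by auto
    have "w * u = q * a j ^ Suc k - q * z + w * y" unfolding wz by (simp add: u algebra_simps)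
    moreover have "\<psi> (q * a j ^ Suc k) = 0" using \<psi>p q by simp
    moreover have "w * y \<in> ?C (\<sigma> + int k * e j)" using hideal_mult[OF y w] unfolding deg .
    moreover have "q * z \<in> ?C (\<sigma> + int k * e j)" using hideal_mult[OF z q] by (simp add: algebra_simps)
    ultimately show "\<psi> (w * u) = 0" using \<psi>C by (simp add: islin_add[OF lin] islin_diff[OF lin])
  next
    fix d u assume u: "u \<in> forms m d" and orth: "\<forall>v\<in>forms m (?s - d). \<psi> (w * (u * v)) = 0"
    have "\<exists>q\<in>forms m (?N - c + d - int (Suc k) * e j). \<exists>y\<in>?C (?N - c + d). w * u = q * a j ^ Suc k + y"
    proof (rule \<psi>d)
      show "w * u \<in> forms m (?N - c + d)" using w u by (rule forms_mult)
      fix v :: "'a mpoly" assume "v \<in> forms m (\<sigma> + int k * e j - (?N - c + d))"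
      then have "v \<in> forms m (?s - d)" by (simp add: algebra_simps)
      then show "\<psi> (w * u * v) = 0" using orth by (simp add: mult.assoc)
    qed
    then obtain q y where q: "q \<in> forms m (d - c)" and y: "y \<in> ?C (?N - c + d)" and wu: "w * u = q * a j ^ Suc k + y"
      by (auto simp: algebra_simps)
    have qb: "q * b \<in> forms m d" using forms_mult[OF q b] by simp
    \<comment> \<open>The relation for \<open>w * u\<close> says that \<open>w * (u - q * b)\<close>
      equals \<open>q * z + y\<close>, which lies in \<open>?C\<close>; \<open>key\<close> then
      cancels \<open>w * b\<close>.\<close>
    have "u - q * b \<in> ?C d"
    proof (rule key)
      show "u - q * b \<in> forms m d" using u qb by blast
      have "(u - q * b) * (w * b) = b * (q * z + y)"
        using wu unfolding wz by algebra
      moreover have "q * z \<in> ?C (?N - c + d)" using hideal_mult[OF z q] by (simp add: algebra_simps)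
      then have "b * (q * z + y) \<in> ?C (c + (?N - c + d))" using y b by (intro hideal_mult) auto
      ultimately show "(u - q * b) * (w * b) \<in> ?C (d + ?N)" by (simp add: algebra_simps)
    qed
    then have "u - q * b \<in> hideal m J (a(j := b)) (e(j := c)) d" by (simp only: C)
    from hideal_insertI[OF J this, of q]
    show "u \<in> hideal m (insert j J) (a(j := b)) (e(j := c)) d" using q by simp
  qed
  then show "\<exists>\<psi>. dualizing m (insert j J) (a(j := b)) (e(j := c)) ?s \<psi>" by blast
qed

subsection \<open>The sequence of variables\<close>

lemma lookup_mult_single: "lkup (p * Poly_Mapping.single \<beta> 1) (\<alpha> + \<beta>) = lkup (p :: 'a::comm_ring_1 mpoly) \<alpha>"
  using subset_UNIV[of "mkeys p"]
  by (induction p rule: mpoly_induct) (simp_all add: mult_single lookup_single lookup_add distrib_right)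

lemma exponent_split:
  assumes "i \<in> mkeys (\<alpha> :: nat \<Rightarrow>\<^sub>0 nat)"
  obtains \<beta> where "\<alpha> = \<beta> + Poly_Mapping.single i 1"
proof (rule that)
  show "\<alpha> = (\<alpha> - Poly_Mapping.single i 1) + Poly_Mapping.single i 1"
    using assms by (intro poly_mapping_eqI) (auto simp: lookup_add lookup_minus lookup_single when_def in_keys_iff)
qed

lemma single_add_var: "Poly_Mapping.single (\<beta> + Poly_Mapping.single i 1) c = Poly_Mapping.single \<beta> c * var i"
  by (simp add: var_def mult_single)

text \<open>The ideal of the first \<open>l\<close> variables is spanned by monomials, so membership
  is decided exponent by exponent.\<close>

lemma hideal_var_iff:
  assumes "l \<le> m" "u \<in> forms m d"
  shows "u \<in> hideal m {..<l} var (\<lambda>_. 1) d \<longleftrightarrow> (\<forall>\<alpha>\<in>mkeys u. \<exists>i<l. i \<in> mkeys \<alpha>)"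
proof
  let ?A = "{\<alpha>. \<exists>i<l. i \<in> mkeys \<alpha>}"
  assume "u \<in> hideal m {..<l} var (\<lambda>_. 1) d"
  then obtain q where q: "u = (\<Sum>i<l. q i * var i)" by (rule hidealE)
  have "q i * var i \<in> supp_in ?A" if "i < l" for i
  proof (rule supp_in_mult)
    show "q i \<in> supp_in UNIV" by (simp add: supp_in_def)
    show "var i \<in> supp_in {Poly_Mapping.single i 1}" by (simp add: var_def)
  qed (use that in \<open>auto simp: keys_add_nat\<close>)
  then have "u \<in> supp_in ?A" unfolding q by (intro supp_in_sum) auto
  then show "\<forall>\<alpha>\<in>mkeys u. \<exists>i<l. i \<in> mkeys \<alpha>" by (auto simp: supp_in_def)
next
  let ?A = "{\<alpha>\<in>exps_eq m d. \<exists>i<l. i \<in> mkeys \<alpha>}"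
  assume "\<forall>\<alpha>\<in>mkeys u. \<exists>i<l. i \<in> mkeys \<alpha>"
  then have "mkeys u \<subseteq> ?A" using assms(2) by (auto simp: supp_in_def)
  then show "u \<in> hideal m {..<l} var (\<lambda>_. 1) d"
  proof (induction u rule: mpoly_induct)
    case (single \<alpha> c)
    then obtain i where i: "i < l" "i \<in> mkeys \<alpha>" and \<alpha>: "\<alpha> \<in> exps_eq m d" by auto
    obtain \<beta> where \<beta>: "\<alpha> = \<beta> + Poly_Mapping.single i 1" using i(2) by (rule exponent_split)
    have "\<beta> \<in> exps_eq m (d - 1)" using \<alpha> unfolding \<beta> by (auto simp: exps_eq_def exps_add monom_deg_add)
    then show ?case
      using i(1) unfolding \<beta> single_add_var
      by (intro hidealI[where q = "\<lambda>k. if k = i then Poly_Mapping.single \<beta> c else 0"])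
        (auto simp: if_distrib[of "\<lambda>x. x * _"] cong: if_cong)
  qed auto
qed

text \<open>Variables are adjoined one at a time: multiplying by \<open>var l\<close> brings no
  variable of smaller index into an exponent, so by the monomial criterion it is injective modulo
  the earlier ones.\<close>

lemma koszul_var:
  assumes "l \<le> m"
  shows "koszul m {..<l} (var :: nat \<Rightarrow> 'a::comm_ring_1 mpoly) (\<lambda>_. 1)"
  using assms
proof (induction l)
  case 0
  show ?case by (rule koszulI) auto
next
  case (Suc l)
  have "nzd m {..<l} (var :: nat \<Rightarrow> 'a mpoly) (\<lambda>_. 1) (var l) 1"
    unfolding nzd_def
  proof (intro allI ballI impI)
    fix d and u :: "'a mpoly" assume u: "u \<in> forms m d" and ul: "u * var l \<in> hideal m {..<l} var (\<lambda>_. 1) (d + 1)"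
    have "u * var l \<in> forms m (d + 1)" using Suc.prems u by (intro forms_mult var_forms) auto
    then have *: "\<forall>\<alpha>\<in>mkeys (u * var l). \<exists>i<l. i \<in> mkeys \<alpha>"
      using ul Suc.prems by (simp add: hideal_var_iff)
    have "\<exists>i<l. i \<in> mkeys \<alpha>" if "\<alpha> \<in> mkeys u" for \<alpha>
    proof -
      have "\<alpha> + Poly_Mapping.single l 1 \<in> mkeys (u * var l)"
        using that by (simp add: in_keys_iff var_def lookup_mult_single)
      then show ?thesis using * by (fastforce simp: keys_add_nat)
    qed
    then show "u \<in> hideal m {..<l} var (\<lambda>_. 1) d"
      using u Suc.prems by (simp add: hideal_var_iff)
  qed
  then show ?case
    unfolding lessThan_Suc using Suc by (intro koszul_insert) (auto intro: var_forms)
qed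

text \<open>Modulo all variables only constants survive, so the socle degree is 0 and the constant
  coefficient serves as functional.\<close>

lemma dualizing_var: "dualizing m {..<m} var (\<lambda>_. 1) 0 (\<lambda>p. lkup p 0)"
  unfolding dualizing_def
proof (intro conjI ballI allI impI)
  show "islin (\<lambda>p :: 'a mpoly. lkup p 0)"
    by (simp add: islin_def lookup_add mscale_def lookup_mconst_mult)
next
  fix u :: "'a mpoly" assume "u \<in> hideal m {..<m} var (\<lambda>_. 1) 0"
  then obtain q where "u = (\<Sum>i<m. q i * var i)" "\<And>i. i < m \<Longrightarrow> q i \<in> forms m (0 - 1)"
    by (auto elim: hidealE)
  then have "u = 0" by (simp add: forms_neg)
  then show "lkup u 0 = 0" by simp
next
  fix d and u :: "'a mpoly" assume u: "u \<in> forms m d" and orth: "\<forall>v\<in>forms m (0 - d). lkup (u * v) 0 = 0"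
  have "\<exists>i<m. i \<in> mkeys \<alpha>" if \<alpha>: "\<alpha> \<in> mkeys u" for \<alpha>
  proof (rule ccontr)
    assume no: "\<not> ?thesis"
    have \<alpha>d: "\<alpha> \<in> exps_eq m d" using u \<alpha> by (auto simp: supp_in_def)
    then have "mkeys \<alpha> \<subseteq> {..<m}" by (simp add: exps_eq_def exps_def)
    then have "mkeys \<alpha> = {}" using no by blast
    then have "\<alpha> = 0" by simp
    with \<alpha>d have "d = 0" by (simp add: exps_eq_def)
    with orth have "lkup (u * 1) 0 = 0" by (metis diff_0_right one_forms)
    then show False using \<alpha> \<open>\<alpha> = 0\<close> by (simp add: in_keys_iff)
  qed
  then show "u \<in> hideal m {..<m} var (\<lambda>_. 1) d" using u by (simp add: hideal_var_iff)
qed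

subsection \<open>Binary forms\<close>

text \<open>Gaussian elimination by induction on the equations: a pivot \<open>k0\<close> removes
  the equation of \<alpha>, and its own unknown is solved for at the end.\<close>

lemma homogeneous_system:
  fixes q :: "'k \<Rightarrow> 'b \<Rightarrow> 'a::field"
  assumes "finite A" "finite S" "card A < card S"
  shows "\<exists>c. (\<exists>k\<in>S. c k \<noteq> 0) \<and> (\<forall>\<alpha>\<in>A. (\<Sum>k\<in>S. c k * q k \<alpha>) = 0)"
  using assms
proof (induction A arbitrary: S q rule: finite_induct)
  case empty
  then have "S \<noteq> {}" by auto
  then show ?case by (intro exI[of _ "\<lambda>_. 1"]) auto
next
  case (insert \<alpha> A)
  show ?case
  proof (cases "\<forall>k\<in>S. q k \<alpha> = 0")
    case True
    have "card A < card S" using insert.prems insert.hyps by simp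
    with insert.IH[OF insert.prems(1), of q] obtain c where
      "\<exists>k\<in>S. c k \<noteq> 0" "\<forall>\<alpha>\<in>A. (\<Sum>k\<in>S. c k * q k \<alpha>) = 0" by blast
    then show ?thesis using True by (intro exI[of _ c]) auto
  next
    case False
    then obtain k0 where k0: "k0 \<in> S" "q k0 \<alpha> \<noteq> 0" by blast
    define T where "T = S - {k0}"
    have S: "S = insert k0 T" "k0 \<notin> T" "finite T" using k0 insert.prems by (auto simp: T_def)
    define q' where "q' k \<beta> = q k \<beta> - q k \<alpha> / q k0 \<alpha> * q k0 \<beta>" for k \<beta>
    have "card A < card T" using insert.prems insert.hyps S by simp
    with insert.IH[OF S(3), of q'] obtain c where
      c: "\<exists>k\<in>T. c k \<noteq> 0" "\<forall>\<beta>\<in>A. (\<Sum>k\<in>T. c k * q' k \<beta>) = 0" by blast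
    define c0 where "c0 = - (\<Sum>k\<in>T. c k * (q k \<alpha> / q k0 \<alpha>))"
    have "(\<Sum>k\<in>S. (c(k0 := c0)) k * q k \<beta>) = (\<Sum>k\<in>T. c k * q' k \<beta>)" for \<beta>
    proof -
      have "(\<Sum>k\<in>T. (c(k0 := c0)) k * q k \<beta>) = (\<Sum>k\<in>T. c k * q k \<beta>)"
        using S by (intro sum.cong) auto
      then show ?thesis
        using S by (simp add: c0_def q'_def right_diff_distrib sum_subtractf sum_distrib_right mult.assoc)
    qed
    moreover have "(\<Sum>k\<in>T. c k * q' k \<alpha>) = 0" using k0 by (simp add: q'_def)
    ultimately have "\<forall>\<beta>\<in>insert \<alpha> A. (\<Sum>k\<in>S. (c(k0 := c0)) k * q k \<beta>) = 0" using c(2) by simp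
    moreover have "\<exists>k\<in>S. (c(k0 := c0)) k \<noteq> 0" using c(1) S by auto
    ultimately show ?thesis by blast
  qed
qed

text \<open>The homogenization of \<open>p\<close> to degree \<open>n\<close>, evaluated at two
  polynomials. \<open>n\<close> may exceed the degree of \<open>p\<close>; each surplus degree
  contributes a factor \<open>y\<close>.\<close>

definition bform :: "nat \<Rightarrow> 'a::field poly \<Rightarrow> 'a mpoly \<Rightarrow> 'a mpoly \<Rightarrow> 'a mpoly" where
  "bform n p x y = (\<Sum>k\<le>n. mconst (coeff p k) * x ^ k * y ^ (n - k))"

lemma bform_add: "bform n (p + q) x y = bform n p x y + bform n q x y"
  by (simp add: bform_def mconst_add distrib_right sum.distrib)

lemma bform_smult: "bform n (smult c p) x y = mconst c * bform n p x y"
  by (simp add: bform_def mconst_mult sum_distrib_left mult.assoc)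

lemma bform_pCons: "bform (Suc n) (pCons 0 p) x y = x * bform n p x y"
  unfolding bform_def sum.atMost_Suc_shift by (simp add: sum_distrib_left mult_ac)

lemma bform_Suc: "degree p \<le> n \<Longrightarrow> bform (Suc n) p x y = y * bform n p x y"
  unfolding bform_def sum.atMost_Suc
  by (simp add: coeff_eq_0 sum_distrib_left Suc_diff_le mult_ac)

lemma bform_add_degree: "degree p \<le> n \<Longrightarrow> bform (n + k) p x y = y ^ k * bform n p x y"
  by (induction k) (simp_all add: bform_Suc mult.assoc)

lemma bform_root: "degree p \<le> n \<Longrightarrow> bform (Suc n) ([:- r, 1:] * p) x y = (x - mconst r * y) * bform n p x y"
proof -
  assume "degree p \<le> n"
  have "[:- r, 1:] * p = smult (- r) p + pCons 0 p" by simp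
  then show ?thesis
    using \<open>degree p \<le> n\<close>
    by (simp only: bform_add bform_smult bform_pCons bform_Suc mconst_minus) (simp add: algebra_simps)
qed

lemma meval_bform:
  "meval (bform n p x y) v = (\<Sum>k\<le>n. coeff p k * meval x v ^ k * meval y v ^ (n - k))"
  by (simp add: bform_def meval_sum meval_mult meval_power)

text \<open>Modulo the ideal of \<open>J\<close> every form of degree \<open>N + t\<close> is a form
  of degree \<open>N\<close> times \<open>var j ^ t\<close>. In large degree the monomials in
  \<open>var i\<close> and \<open>var j\<close> outnumber all monomials of degree \<open>N\<close>,
  so a nontrivial combination of them lies in the ideal.\<close>

lemma binary_form:
  fixes a :: "nat \<Rightarrow> 'a::field mpoly"
  assumes J: "finite J" "j \<notin> J" and ij: "i < m" "j < m" and aj: "a j = var j" "e j = 1"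
    and high: "\<And>d u. d > \<sigma> \<Longrightarrow> u \<in> forms m d \<Longrightarrow> u \<in> hideal m (insert j J) a e d"
  shows "\<exists>p n. p \<noteq> 0 \<and> degree p \<le> n \<and> bform n p (var i) (var j) \<in> hideal m J a e (int n)"
proof -
  define N where "N = nat \<sigma>"
  have red: "\<exists>q\<in>forms m (int N). \<exists>y\<in>hideal m J a e (int (N + t)). u = q * var j ^ t + y"
    if "u \<in> forms m (int (N + t))" for u t
    using that
  proof (induction t arbitrary: u)
    case 0
    then show ?case by (intro bexI[of _ u] bexI[of _ 0]) auto
  next
    case (Suc t)
    have "u \<in> hideal m (insert j J) a e (int (N + Suc t))"
      using Suc.prems by (intro high) (auto simp: N_def)
    then obtain q y where q: "q \<in> forms m (int (N + t))" and y: "y \<in> hideal m J a e (int (N + Suc t))"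
      and u: "u = q * var j + y"
      unfolding hideal_insert[OF J] aj by auto
    obtain r z where r: "r \<in> forms m (int N)" and z: "z \<in> hideal m J a e (int (N + t))" and qr: "q = r * var j ^ t + z"
      using Suc.IH[OF q] by blast
    have "var j * z \<in> hideal m J a e (1 + int (N + t))"
      by (rule hideal_mult[OF z var_forms[OF ij(2)]])
    then have "var j * z \<in> hideal m J a e (int (N + Suc t))" by (simp add: add_ac)
    then have "var j * z + y \<in> hideal m J a e (int (N + Suc t))" using y by (rule hideal_add)
    moreover have "u = r * var j ^ Suc t + (var j * z + y)" by (simp add: u qr algebra_simps)
    ultimately show ?case using r by blast
  qed
  let ?A = "exps_eq m (int N)"
  \<comment> \<open>With \<open>t\<close> the number of monomials of degree \<open>N\<close>, the
    \<open>n + 1\<close> products \<open>var i ^ k * var j ^ (n - k)\<close> are too many for their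
    cofactors of degree \<open>N\<close> to be independent.\<close>
  define t where "t = card ?A"
  define n where "n = N + t"
  have fin: "finite ?A" using finite_exps_le exps_eq_le finite_subset by metis
  have xf: "var i ^ k * var j ^ (n - k) \<in> forms m (int n)" if "k \<le> n" for k
    using forms_mult[OF forms_power[OF var_forms[OF ij(1)], of k] forms_power[OF var_forms[OF ij(2)], of "n - k"]] that
    by simp
  have "\<forall>k\<in>{..n}. \<exists>q y. q \<in> forms m (int N) \<and> y \<in> hideal m J a e (int n) \<and> var i ^ k * var j ^ (n - k) = q * var j ^ t + y"
    using red[of _ t] xf unfolding n_def by blast
  then obtain q y where qy: "\<And>k. k \<le> n \<Longrightarrow> q k \<in> forms m (int N)" "\<And>k. k \<le> n \<Longrightarrow> y k \<in> hideal m J a e (int n)"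
    "\<And>k. k \<le> n \<Longrightarrow> var i ^ k * var j ^ (n - k) = q k * var j ^ t + y k"
    by (metis atMost_iff)
  have "card ?A < card {..n}" by (simp add: n_def t_def)
  then obtain c where c: "\<exists>k\<in>{..n}. c k \<noteq> 0" "\<forall>\<alpha>\<in>?A. (\<Sum>k\<le>n. c k * lkup (q k) \<alpha>) = 0"
    using homogeneous_system[OF fin, of "{..n}" "\<lambda>k. lkup (q k)"] by auto
  \<comment> \<open>The combination of the cofactors \<open>q k\<close> vanishes, so only the parts
    \<open>y k\<close> from the ideal remain of the binary form.\<close>
  have dep: "(\<Sum>k\<le>n. mconst (c k) * q k) = 0"
  proof (rule poly_mapping_eqI)
    fix \<alpha>
    have "lkup (q k) \<alpha> = 0" if "\<alpha> \<notin> ?A" "k \<le> n" for k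
      using qy(1)[OF that(2)] that(1) by (auto simp: supp_in_def in_keys_iff)
    then show "lkup (\<Sum>k\<le>n. mconst (c k) * q k) \<alpha> = lkup 0 \<alpha>"
      using c(2) by (cases "\<alpha> \<in> ?A") (simp_all add: lookup_sum lookup_mconst_mult)
  qed
  define p where "p = (\<Sum>k\<le>n. monom (c k) k)"
  have coeff: "coeff p k = (if k \<le> n then c k else 0)" for k
    by (simp add: p_def coeff_sum)
  have "bform n p (var i) (var j) = (\<Sum>k\<le>n. mconst (c k) * (q k * var j ^ t + y k))"
    by (simp add: bform_def coeff mult.assoc qy(3)[symmetric])
  also have "\<dots> = (\<Sum>k\<le>n. mconst (c k) * q k) * var j ^ t + (\<Sum>k\<le>n. mconst (c k) * y k)"
    by (simp add: distrib_left sum.distrib sum_distrib_right mult.assoc)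
  also have "\<dots> = (\<Sum>k\<le>n. mscale (c k) (y k))" by (simp add: dep mscale_def)
  also have "\<dots> \<in> hideal m J a e (int n)" by (intro hideal_sum hideal_mscale qy) auto
  finally have "bform n p (var i) (var j) \<in> hideal m J a e (int n)" .
  moreover have "p \<noteq> 0" using c(1) coeff by (metis atMost_iff coeff_0)
  moreover have "degree p \<le> n" by (rule degree_le) (simp add: coeff)
  ultimately show ?thesis by blast
qed

subsection \<open>Points of a one-dimensional graded ideal\<close>

text \<open>Ungraded ideals suffice for the argument about points; homogeneity is restored
  afterwards by projecting to one degree.\<close>

definition is_ideal :: "'r::comm_ring_1 set \<Rightarrow> bool" where
  "is_ideal J \<longleftrightarrow> 0 \<in> J \<and> (\<forall>x\<in>J. \<forall>y\<in>J. x + y \<in> J) \<and> (\<forall>r. \<forall>x\<in>J. r * x \<in> J)"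

definition adjoin :: "'r::comm_ring_1 set \<Rightarrow> 'r \<Rightarrow> 'r set" where
  "adjoin J z = {u + r * z | u r. u \<in> J}"

lemma is_idealD:
  assumes "is_ideal J"
  shows "0 \<in> J" "\<And>x y. x \<in> J \<Longrightarrow> y \<in> J \<Longrightarrow> x + y \<in> J" "\<And>r x. x \<in> J \<Longrightarrow> r * x \<in> J"
  using assms unfolding is_ideal_def by blast+

lemma is_ideal_adjoin:
  assumes "is_ideal J"
  shows "is_ideal (adjoin J z)" "J \<subseteq> adjoin J z" "z \<in> adjoin J z"
proof -
  note J = is_idealD[OF assms]
  have in_adj: "u + r * z \<in> adjoin J z" if "u \<in> J" for u r using that by (auto simp: adjoin_def)
  show "J \<subseteq> adjoin J z" using in_adj[of _ 0] by auto
  show "z \<in> adjoin J z" using in_adj[OF J(1), of 1] by simp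
  show "is_ideal (adjoin J z)"
    unfolding is_ideal_def
  proof (intro conjI ballI allI)
    show "0 \<in> adjoin J z" using in_adj[OF J(1), of 0] by simp
  next
    fix x y assume "x \<in> adjoin J z" "y \<in> adjoin J z"
    then obtain u r v s where "x = u + r * z" "y = v + s * z" "u \<in> J" "v \<in> J" by (auto simp: adjoin_def)
    then show "x + y \<in> adjoin J z" using in_adj[OF J(2), of u v "r + s"] by (simp add: algebra_simps)
  next
    fix t x assume "x \<in> adjoin J z"
    then obtain u r where "x = u + r * z" "u \<in> J" by (auto simp: adjoin_def)
    then show "t * x \<in> adjoin J z" using in_adj[OF J(3), of u t "t * r"] by (simp add: algebra_simps)
  qed
qed

section \<open>An elementary Nullstellensatz by adjoining linear relations\<close>

lemma mconst_cancel:
  assumes "is_ideal J" "mconst c * x \<in> J" "(c::'a::field) \<noteq> 0"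
  shows "x \<in> J"
proof -
  have "mconst (inverse c) * (mconst c * x) = mconst (inverse c * c) * x"
    by (simp add: mconst_mult mult.assoc)
  also have "\<dots> = x" using assms(3) by simp
  finally show ?thesis using is_idealD(3)[OF assms(1,2)] by metis
qed

text \<open>Split off a root \<open>r\<close> of \<open>p\<close>, with cofactor \<open>g\<close>.
  If adjoining \<open>x - mconst r * y\<close> captures some \<open>y ^ k\<close>, multiplying by
  the form of \<open>g\<close> puts that form, padded by \<open>y ^ k\<close>, into
  \<open>J\<close>. So either \<open>r\<close> works or the degree of \<open>p\<close> drops; a
  nonzero constant would put a power of \<open>y\<close> into \<open>J\<close>.\<close>

lemma root_step:
  fixes J :: "'a::alg_closed_field mpoly set"
  assumes J: "is_ideal J" and Y: "\<And>k. y ^ k \<notin> J" and p: "p \<noteq> 0" "degree p \<le> n" "bform n p x y \<in> J"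
  shows "\<exists>r. \<forall>k. y ^ k \<notin> adjoin J (x - mconst r * y)"
  using p
proof (induction "degree p" arbitrary: p n)
  case 0
  then obtain c where c: "p = [:c:]" by (metis degree_eq_zeroE)
  have "bform n p x y = mconst c * y ^ n"
    using bform_add_degree[of p 0 n x y] c by (simp add: bform_def mult.commute)
  then have "y ^ n \<in> J" using mconst_cancel[OF J, of c "y ^ n"] 0 c by auto
  then show ?case using Y by blast
next
  case (Suc dg)
  obtain r where "poly p r = 0" using alg_closed_imp_poly_has_root[of p] Suc.hyps(2) by auto
  then obtain g where g: "p = [:- r, 1:] * g" by (metis poly_eq_0_iff_dvd dvdE)
  have g0: "g \<noteq> 0" using g Suc.prems by auto
  have dg: "degree p = Suc (degree g)" unfolding g using g0 by (subst degree_mult_eq) auto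
  obtain n' where n': "n = Suc n'" "degree g \<le> n'" using dg Suc.prems(2) by (cases n) auto
  show ?case
  proof (cases "\<exists>k. y ^ k \<in> adjoin J (x - mconst r * y)")
    case True
    then obtain k u s where u: "y ^ k = u + s * (x - mconst r * y)" "u \<in> J" by (auto simp: adjoin_def)
    have "y ^ k * bform n' g x y = bform n' g x y * u + s * bform n p x y"
      unfolding n' g bform_root[OF n'(2)] u(1) by (simp add: algebra_simps)
    also have "\<dots> \<in> J" using is_idealD[OF J] u Suc.prems by blast
    finally have "bform (n' + k) g x y \<in> J" by (simp add: bform_add_degree[OF n'(2)])
    then show ?thesis using Suc.hyps(1)[of g "n' + k"] Suc.hyps(2) dg g0 n'(2) by simp
  qed blast
qed

text \<open>The variables are specialised one by one to multiples of \<open>y\<close> while all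
  powers of \<open>y\<close> stay outside; the ratios \<open>r i\<close> are the coordinates of a
  point.\<close>

lemma ideal_point:
  fixes J :: "'a::alg_closed_field mpoly set"
  assumes J: "is_ideal J" and Y: "\<And>k. y ^ k \<notin> J"
    and p: "\<And>i. i < l \<Longrightarrow> \<exists>p n. p \<noteq> 0 \<and> degree p \<le> n \<and> bform n p (var i) y \<in> J"
  shows "\<exists>r J'. is_ideal J' \<and> J \<subseteq> J' \<and> (\<forall>k. y ^ k \<notin> J') \<and> (\<forall>i<l. var i - mconst (r i) * y \<in> J') \<and> (\<forall>i\<ge>l. r i = 0)"
  using p
proof (induction l)
  case 0
  show ?case using J Y by (intro exI[of _ "\<lambda>_. 0"] exI[of _ J]) auto
next
  case (Suc l)
  then obtain r J' where J': "is_ideal J'" "J \<subseteq> J'" "\<And>k. y ^ k \<notin> J'" "\<And>i. i < l \<Longrightarrow> var i - mconst (r i) * y \<in> J'"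
      "\<And>i. i \<ge> l \<Longrightarrow> r i = 0"
    by (metis less_SucI)
  obtain p n where p: "p \<noteq> 0" "degree p \<le> n" "bform n p (var l) y \<in> J'"
    using Suc.prems[of l] J'(2) by blast
  obtain c where c: "\<forall>k. y ^ k \<notin> adjoin J' (var l - mconst c * y)"
    using root_step[OF J'(1,3) p] by blast
  let ?K = "adjoin J' (var l - mconst c * y)"
  note K = is_ideal_adjoin[OF J'(1), of "var l - mconst c * y"]
  have "var i - mconst ((r(l := c)) i) * y \<in> ?K" if "i < Suc l" for i
    using that J'(4)[of i] K by (cases "i = l") auto
  then show ?case
    using K c J' by (intro exI[of _ "r(l := c)"] exI[of _ ?K]) auto
qed

text \<open>Each variable is a multiple of \<open>y\<close> modulo \<open>J\<close>, so a monomial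
  collapses to its value at \<open>r\<close> times a power of \<open>y\<close>.\<close>

lemma mon_eval_cong_ideal:
  assumes J: "is_ideal J" and r: "\<And>i. i < m \<Longrightarrow> var i - mconst (r i) * y \<in> J" and "\<alpha> \<in> exps m"
  shows "Poly_Mapping.single \<alpha> 1 - mconst (mon_eval \<alpha> r) * y ^ monom_deg \<alpha> \<in> J"
  using assms(3)
proof (induction "monom_deg \<alpha>" arbitrary: \<alpha>)
  case 0
  then have "\<alpha> = 0" by simp
  then show ?case using is_idealD(1)[OF J] by simp
next
  case (Suc n)
  have "\<alpha> \<noteq> 0" using Suc.hyps(2) by auto
  then have "mkeys \<alpha> \<noteq> {}" by simp
  then obtain i where i: "i \<in> mkeys \<alpha>" by blast
  then have im: "i < m" using Suc.prems by (auto simp: exps_def)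
  obtain \<beta> where \<beta>: "\<alpha> = \<beta> + Poly_Mapping.single i 1" using i by (rule exponent_split)
  have d: "monom_deg \<alpha> = Suc (monom_deg \<beta>)" by (simp add: \<beta> monom_deg_add)
  have IH: "Poly_Mapping.single \<beta> 1 - mconst (mon_eval \<beta> r) * y ^ monom_deg \<beta> \<in> J"
    using Suc.hyps(1)[of \<beta>] Suc.hyps(2) Suc.prems d by (simp add: \<beta> exps_add)
  have "Poly_Mapping.single \<alpha> 1 - mconst (mon_eval \<alpha> r) * y ^ monom_deg \<alpha> =
      Poly_Mapping.single \<beta> 1 * (var i - mconst (r i) * y) +
      (mconst (r i) * y) * (Poly_Mapping.single \<beta> 1 - mconst (mon_eval \<beta> r) * y ^ monom_deg \<beta>)"
    unfolding d unfolding \<beta> single_add_var by (simp add: mon_eval_add mconst_mult algebra_simps)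
  also have "\<dots> \<in> J" using is_idealD[OF J] r[OF im] IH by blast
  finally show ?case .
qed

lemma form_cong_ideal:
  assumes J: "is_ideal J" and r: "\<And>i. i < m \<Longrightarrow> var i - mconst (r i) * y \<in> J" and "F \<in> forms m (int n)"
  shows "F - mconst (meval F r) * y ^ n \<in> J"
proof -
  have "mkeys F \<subseteq> exps_eq m (int n)" using assms(3) by (simp add: supp_in_def)
  then show ?thesis
  proof (induction F rule: mpoly_induct)
    case zero
    then show ?case using is_idealD(1)[OF J] by simp
  next
    case (single \<alpha> c)
    then have "\<alpha> \<in> exps m" "monom_deg \<alpha> = n" by (auto simp: exps_eq_def)
    then have "mconst c * (Poly_Mapping.single \<alpha> 1 - mconst (mon_eval \<alpha> r) * y ^ n) \<in> J"
      using mon_eval_cong_ideal[OF J r] is_idealD(3)[OF J] by blast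
    moreover have "mconst c * Poly_Mapping.single \<alpha> 1 = Poly_Mapping.single \<alpha> c"
      by (simp add: mconst_def mult_single)
    ultimately show ?case by (simp add: right_diff_distrib mconst_mult mult.assoc)
  next
    case (add p q)
    then have "(p - mconst (meval p r) * y ^ n) + (q - mconst (meval q r) * y ^ n) \<in> J"
      using is_idealD(2)[OF J] by blast
    then show ?case by (simp add: meval_add mconst_add algebra_simps)
  qed
qed

text \<open>Nullstellensatz on the chart where coordinate \<open>j\<close> is 1: if no power of
  \<open>var j\<close> lay in the ideal, there would be a point \<open>r\<close> and a larger ideal
  \<open>J'\<close>, still without powers of \<open>var j\<close>, modulo which each
  \<open>a i\<close> is \<open>meval (a i) r\<close> times such a power. A nonzero value then puts
  that power into \<open>J'\<close>.\<close>

lemma power_in_hideal: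
  fixes a :: "nat \<Rightarrow> 'a::alg_closed_field mpoly"
  assumes I: "finite I" and j: "j < m" and e: "\<And>i. i \<in> I \<Longrightarrow> e i \<ge> 0" and a: "\<And>i. i \<in> I \<Longrightarrow> a i \<in> forms m (e i)"
    and p: "\<And>i. i < m \<Longrightarrow> \<exists>p n. p \<noteq> 0 \<and> degree p \<le> n \<and> bform n p (var i) (var j) \<in> hideal m I a e (int n)"
    and no_pt: "\<And>v. v j = 1 \<Longrightarrow> (\<And>i. i \<ge> m \<Longrightarrow> v i = 0) \<Longrightarrow> \<exists>i\<in>I. meval (a i) v \<noteq> 0"
  shows "\<exists>k. var j ^ Suc k \<in> hideal m I a e (int (Suc k))"
proof -
  define J where "J = {\<Sum>i\<in>I. q i * a i | q. True}"
  have JI: "(\<Sum>i\<in>I. q i * a i) \<in> J" for q by (auto simp: J_def)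
  have hJ: "hideal m I a e d \<subseteq> J" for d by (auto simp: hideal_def J_def)
  have J: "is_ideal J"
    unfolding is_ideal_def
  proof (intro conjI ballI allI)
    show "0 \<in> J" using JI[of "\<lambda>_. 0"] by simp
  next
    fix x y assume "x \<in> J" "y \<in> J"
    then obtain q r where "x = (\<Sum>i\<in>I. q i * a i)" "y = (\<Sum>i\<in>I. r i * a i)" by (auto simp: J_def)
    then show "x + y \<in> J" using JI[of "\<lambda>i. q i + r i"] by (simp add: distrib_right sum.distrib)
  next
    fix t x assume "x \<in> J"
    then obtain q where "x = (\<Sum>i\<in>I. q i * a i)" by (auto simp: J_def)
    then show "t * x \<in> J" using JI[of "\<lambda>i. t * q i"] by (simp add: sum_distrib_left mult.assoc)
  qed
  have aJ: "a i \<in> J" if "i \<in> I" for i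
    using JI[of "\<lambda>k. if k = i then 1 else 0"] that I by (simp add: if_distrib[of "\<lambda>x. x * _"] cong: if_cong)
  have "\<exists>k. var j ^ k \<in> J"
  proof (rule ccontr)
    assume no: "\<nexists>k. var j ^ k \<in> J"
    have "\<exists>r J'. is_ideal J' \<and> J \<subseteq> J' \<and> (\<forall>k. var j ^ k \<notin> J') \<and> (\<forall>i<m. var i - mconst (r i) * var j \<in> J') \<and> (\<forall>i\<ge>m. r i = 0)"
    proof (rule ideal_point[OF J])
      show "\<exists>p n. p \<noteq> 0 \<and> degree p \<le> n \<and> bform n p (var i) (var j) \<in> J" if "i < m" for i
        using p[OF that] hJ by blast
    qed (use no in blast)
    then obtain r J' where J': "is_ideal J'" "J \<subseteq> J'" "\<And>k. var j ^ k \<notin> J'" "\<And>i. i < m \<Longrightarrow> var i - mconst (r i) * var j \<in> J'"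
      "\<And>i. i \<ge> m \<Longrightarrow> r i = 0" by blast
    \<comment> \<open>The relation at the index \<open>j\<close> itself is \<open>var j\<close>
      times the constant \<open>1 - r j\<close>, which captures \<open>var j\<close> unless
      \<open>r j = 1\<close>.\<close>
    have "r j = 1"
    proof (rule ccontr)
      assume "r j \<noteq> 1"
      have "mconst (1 - r j) = 1 - mconst (r j)"
        using mconst_add[of "1 - r j" "r j"] by (simp add: eq_diff_eq)
      then have "mconst (1 - r j) * var j \<in> J'"
        using J'(4)[OF j] by (simp add: left_diff_distrib)
      then have "var j \<in> J'" using mconst_cancel[OF J'(1)] \<open>r j \<noteq> 1\<close> by fastforce
      then show False using J'(3)[of 1] by simp
    qed
    then obtain i where i: "i \<in> I" "meval (a i) r \<noteq> 0" using no_pt J'(5) by blast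
    obtain n where n: "e i = int n" using e[OF i(1)] by (metis nonneg_int_cases)
    have "a i - mconst (meval (a i) r) * var j ^ n \<in> J'"
      using form_cong_ideal[OF J'(1,4)] a[OF i(1)] n by metis
    moreover have "- 1 * a i \<in> J'" using aJ[OF i(1)] J'(2) is_idealD(3)[OF J'(1)] by blast
    ultimately have "(a i - mconst (meval (a i) r) * var j ^ n) + - 1 * a i \<in> J'"
      by (rule is_idealD(2)[OF J'(1)])
    then have "- (mconst (meval (a i) r) * var j ^ n) \<in> J'" by simp
    then have "- 1 * (- (mconst (meval (a i) r) * var j ^ n)) \<in> J'"
      by (rule is_idealD(3)[OF J'(1)])
    then have "mconst (meval (a i) r) * var j ^ n \<in> J'" by simp
    then show False using mconst_cancel[OF J'(1) _ i(2)] J'(3) by blast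
  qed
  then obtain k where "var j ^ k \<in> J" by blast
  \<comment> \<open>One extra factor gives the exponent the form \<open>Suc k\<close> that the
    exchange of generators asks for.\<close>
  then have "var j * var j ^ k \<in> J" by (rule is_idealD(3)[OF J])
  then obtain q where q: "var j ^ Suc k = (\<Sum>i\<in>I. q i * a i)" by (auto simp: J_def)
  \<comment> \<open>Taking the component of degree \<open>Suc k\<close> replaces the coefficients by
    forms of the right degrees.\<close>
  let ?E = "\<lambda>d. restr (exps_eq m d)"
  have "var j ^ Suc k \<in> forms m (int (Suc k))"
    using forms_power[OF var_forms[OF j], of "Suc k"] by simp
  then have "var j ^ Suc k = ?E (int (Suc k)) (\<Sum>i\<in>I. q i * a i)" using q restr_eq by metis
  also have "\<dots> = (\<Sum>i\<in>I. ?E (int (Suc k) - e i) (q i) * a i)"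
    unfolding restr_sum by (intro sum.cong refl restr_forms_mult a)
  finally have "var j ^ Suc k \<in> hideal m I a e (int (Suc k))" by (rule hidealI) simp
  then show ?thesis by blast
qed

text \<open>At a zero with \<open>v j = 1\<close> the binary form in \<open>var i\<close> and
  \<open>var j\<close> becomes \<open>p\<close> at \<open>v i\<close>, so every coordinate is one of
  finitely many roots.\<close>

lemma finite_points:
  fixes a :: "nat \<Rightarrow> 'a::field mpoly"
  assumes p: "\<And>i. i < m \<Longrightarrow> \<exists>p n. p \<noteq> 0 \<and> degree p \<le> n \<and> bform n p (var i) (var j) \<in> hideal m J a e (int n)"
  shows "finite {v. v j = 1 \<and> (\<forall>i\<ge>m. v i = 0) \<and> (\<forall>i\<in>J. meval (a i) v = 0)}" (is "finite ?Z")
proof -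
  obtain p n where p: "\<And>i. i < m \<Longrightarrow> p i \<noteq> 0" "\<And>i. i < m \<Longrightarrow> degree (p i) \<le> n i"
      "\<And>i. i < m \<Longrightarrow> bform (n i) (p i) (var i) (var j) \<in> hideal m J a e (int (n i))"
    using p by metis
  let ?B = "\<Union>i<m. {x. poly (p i) x = 0}"
  have "finite ?B" using p(1) poly_roots_finite by blast
  then have "finite {v. \<forall>i. (i \<in> {..<m} \<longrightarrow> v i \<in> ?B) \<and> (i \<notin> {..<m} \<longrightarrow> v i = 0)}"
    by (intro finite_set_of_finite_funs) auto
  moreover have "v i \<in> ?B" if v: "v \<in> ?Z" and i: "i < m" for v i
  proof -
    obtain q where q: "bform (n i) (p i) (var i) (var j) = (\<Sum>k\<in>J. q k * a k)"
      using p(3)[OF i] by (rule hidealE)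
    have "meval (bform (n i) (p i) (var i) (var j)) v = 0"
      using v unfolding q by (simp add: meval_sum meval_mult)
    then have "(\<Sum>k\<le>n i. coeff (p i) k * v i ^ k) = 0"
      using v p(2)[OF i] by (simp add: meval_bform)
    moreover have "poly (p i) (v i) = (\<Sum>k\<le>n i. coeff (p i) k * v i ^ k)"
      unfolding poly_altdef using p(2)[OF i]
      by (intro sum.mono_neutral_left) (auto simp: coeff_eq_0)
    ultimately show ?thesis using i by auto
  qed
  ultimately show ?thesis
    by (elim finite_subset[rotated]) auto
qed

text \<open>If the field were finite, 1 plus the product of all linear factors would be nonconstant
  without a root.\<close>

lemma infinite_alg_closed: "infinite (UNIV :: 'a::alg_closed_field set)"
proof
  assume fin: "finite (UNIV :: 'a set)"
  define p where "p = 1 + (\<Prod>x\<in>(UNIV :: 'a set). [:- x, 1:])"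
  have "degree (\<Prod>x\<in>(UNIV :: 'a set). [:- x, 1:]) = card (UNIV :: 'a set)"
    by (subst degree_prod_eq_sum_degree) auto
  moreover have "card (UNIV :: 'a set) > 0" using fin by (simp add: card_gt_0_iff)
  ultimately have "degree p > 0"
    unfolding p_def by (subst degree_add_eq_right) auto
  then obtain x where "poly p x = 0" using alg_closed_imp_poly_has_root by blast
  moreover have "poly (\<Prod>x\<in>(UNIV :: 'a set). [:- x, 1:]) x = 0"
    using fin by (auto simp: poly_prod)
  ultimately show False by (simp add: p_def)
qed

subsection \<open>Triangular combinations forming a regular sequence\<close>

text \<open>The powers of \<open>var i\<close> bring all terms to degree \<open>d i\<close>.
  \<open>F i\<close> itself has coefficient 1, which makes the family triangular, and the distinct
  powers of \<open>c\<close> make the value at a point a polynomial in \<open>c\<close>.\<close>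

definition comb :: "nat \<Rightarrow> (nat \<Rightarrow> nat) \<Rightarrow> 'a::field \<Rightarrow> nat \<Rightarrow> (nat \<Rightarrow> 'a mpoly) \<Rightarrow> 'a mpoly" where
  "comb s d c i F = (\<Sum>l\<in>{i..<s}. mconst (c ^ (l - i)) * var i ^ (d i - d l) * F l)"

lemma comb_coeff_forms:
  assumes "i < m" "d l \<le> d i"
  shows "mconst c * var i ^ (d i - d l) \<in> forms m (int (d i) - int (d l))"
  using forms_mult[OF mconst_forms[of c m] forms_power[OF var_forms[OF assms(1)], of "d i - d l"]] assms(2)
  by (simp add: of_nat_diff)

lemma comb_forms:
  assumes "i < m" "\<And>l. i \<le> l \<Longrightarrow> l < s \<Longrightarrow> d l \<le> d i" "\<And>l. l < s \<Longrightarrow> F l \<in> forms m (int (d l))"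
  shows "comb s d c i F \<in> forms m (int (d i))"
  unfolding comb_def
proof (rule supp_in_sum)
  fix l assume l: "l \<in> {i..<s}"
  have "mconst (c ^ (l - i)) * var i ^ (d i - d l) * F l \<in> forms m (int (d i) - int (d l) + int (d l))"
    using assms l by (intro forms_mult comb_coeff_forms) auto
  then show "mconst (c ^ (l - i)) * var i ^ (d i - d l) * F l \<in> forms m (int (d i))" by simp
qed

lemma comb_unfold: "i < s \<Longrightarrow> comb s d c i F = F i + (\<Sum>l\<in>{Suc i..<s}. mconst (c ^ (l - i)) * var i ^ (d i - d l) * F l)"
  unfolding comb_def by (subst sum.atLeast_Suc_lessThan) auto

lemma meval_comb:
  "meval (comb s d c i F) v = (\<Sum>l\<in>{i..<s}. c ^ (l - i) * v i ^ (d i - d l) * meval (F l) v)"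
  by (simp add: comb_def meval_sum meval_mult meval_power)

text \<open>Back substitution: in the combination at \<open>k\<close> the form \<open>F k\<close>
  has coefficient 1 and all others have larger index, so vanishing propagates downwards from
  \<open>l\<close>.\<close>

lemma comb_zeros:
  assumes "l \<le> s" "\<And>k. k < l \<Longrightarrow> meval (comb s d (\<kappa> k) k F) v = 0" "\<And>k. l \<le> k \<Longrightarrow> k < s \<Longrightarrow> meval (F k) v = 0"
    and "k < s"
  shows "meval (F k) v = 0"
proof -
  have "\<forall>t\<in>{n..<s}. meval (F t) v = 0" if "n \<le> l" for n
    using that
  proof (induction rule: inc_induct)
    case base
    then show ?case using assms by auto
  next
    case (step n)
    have ns: "n < s" using step assms(1) by simp
    have "meval (F n) v = meval (comb s d (\<kappa> n) n F) v"
      unfolding comb_unfold[OF ns] using step.IH by (simp add: meval_add meval_sum meval_mult)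
    then have "meval (F n) v = 0" using assms(2) step by simp
    then show ?case using step.IH by (metis atLeastLessThan_iff le_antisym not_less_eq_eq)
  qed
  then show ?thesis using assms(4) by fastforce
qed

text \<open>Starting from the variables, one after another is exchanged for a generic combination;
  each exchange raises the socle degree by \<open>int (d l) - 1\<close>.\<close>

lemma regular_combination:
  fixes F :: "nat \<Rightarrow> 'a::alg_closed_field mpoly"
  assumes ms: "m \<le> s" and F: "\<And>i. i < s \<Longrightarrow> F i \<in> forms m (int (d i))"
    and sorted: "\<And>i j. i \<le> j \<Longrightarrow> j < s \<Longrightarrow> d j \<le> d i"
    and no_zero: "\<And>v i. (\<And>i. i \<ge> m \<Longrightarrow> v i = 0) \<Longrightarrow> i < m \<Longrightarrow> v i \<noteq> 0 \<Longrightarrow> \<exists>i<s. meval (F i) v \<noteq> 0"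
    and "l \<le> m"
  shows "\<exists>\<kappa> \<phi>. koszul m {..<m} (\<lambda>i. if i < l then comb s d (\<kappa> i) i F else var i) (\<lambda>i. if i < l then int (d i) else 1) \<and>
    dualizing m {..<m} (\<lambda>i. if i < l then comb s d (\<kappa> i) i F else var i) (\<lambda>i. if i < l then int (d i) else 1)
      (\<Sum>i<l. int (d i) - 1) \<phi>"
  using \<open>l \<le> m\<close>
proof (induction l)
  case 0
  show ?case using koszul_var[of m m] dualizing_var[of m] by auto
next
  case (Suc l)
  then have lm: "l < m" by simp
  define e where "e i = (if i < l then int (d i) else 1)" for i
  define \<sigma> where "\<sigma> = (\<Sum>i<l. int (d i) - 1)"
  obtain \<kappa> \<phi> where IH: "koszul m {..<m} (\<lambda>i. if i < l then comb s d (\<kappa> i) i F else var i) (\<lambda>i. if i < l then int (d i) else 1)"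
    "dualizing m {..<m} (\<lambda>i. if i < l then comb s d (\<kappa> i) i F else var i) (\<lambda>i. if i < l then int (d i) else 1) (\<Sum>i<l. int (d i) - 1) \<phi>"
    using Suc by auto
  define a where "a i = (if i < l then comb s d (\<kappa> i) i F else var i)" for i
  define J where "J = {..<m} - {l}"
  have J: "finite J" "l \<notin> J" "insert l J = {..<m}" using lm by (auto simp: J_def)
  have K: "koszul m (insert l J) a e" and dual: "dualizing m (insert l J) a e \<sigma> \<phi>"
    using IH unfolding J(3) a_def[abs_def] e_def[abs_def] \<sigma>_def by blast+
  have al: "a l = var l" "e l = 1" by (simp_all add: a_def e_def)
  have af: "a i \<in> forms m (e i)" if "i < m" for i
    using that ms sorted F by (auto simp: a_def e_def intro!: comb_forms var_forms)
  \<comment> \<open>Duality puts all forms of high degree into the ideal of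
    \<open>insert l J\<close>, which supplies the binary forms in the ideal of the remaining
    generators.\<close>
  have bf: "\<exists>p n. p \<noteq> 0 \<and> degree p \<le> n \<and> bform n p (var i) (var l) \<in> hideal m J a e (int n)" if "i < m" for i
    by (rule binary_form[of J l i m a e \<sigma>])
      (use J that lm al dualizing_high_degree[OF dual] in auto)
  define Z where "Z = {v. v l = 1 \<and> (\<forall>i\<ge>m. v i = 0) \<and> (\<forall>i\<in>J. meval (a i) v = 0)}"
  have finZ: "finite Z" unfolding Z_def by (rule finite_points[OF bf])
  \<comment> \<open>At a point of \<open>Z\<close> the coordinate \<open>l\<close> is 1, so the
    padding powers disappear and \<open>poly (P v) c\<close> is the value of the combination with
    parameter \<open>c\<close>.\<close>
  define P where "P v = (\<Sum>k\<in>{l..<s}. monom (meval (F k) v) (k - l))" for v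
  have P: "P v \<noteq> 0" if v: "v \<in> Z" for v
  proof
    assume P0: "P v = 0"
    \<comment> \<open>If \<open>P v\<close> is zero, all \<open>F k\<close> with
      \<open>l \<le> k\<close> vanish at \<open>v\<close>; back substitution extends this to smaller
      \<open>k\<close>, which contradicts \<open>v l = 1\<close>.\<close>
    have "meval (F k) v = 0" if "l \<le> k" "k < s" for k
    proof -
      have "coeff (P v) (k - l) = (\<Sum>t\<in>{l..<s}. if t = k then meval (F k) v else 0)"
        unfolding P_def coeff_sum using that by (intro sum.cong) auto
      also have "\<dots> = meval (F k) v" using that by simp
      finally show ?thesis using P0 by simp
    qed
    moreover have "meval (comb s d (\<kappa> k) k F) v = 0" if "k < l" for k
    proof -
      have "k \<in> J" using that lm by (simp add: J_def)
      then have "meval (a k) v = 0" using v by (simp add: Z_def)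
      then show ?thesis using that by (simp add: a_def)
    qed
    ultimately have "meval (F k) v = 0" if "k < s" for k
      using comb_zeros[of l s d \<kappa> F v k] that lm ms by auto
    moreover have "\<exists>k<s. meval (F k) v \<noteq> 0"
      using v lm by (intro no_zero[of v l]) (auto simp: Z_def)
    ultimately show False by blast
  qed
  have "finite (\<Union>v\<in>Z. {x. poly (P v) x = 0})" using finZ P poly_roots_finite by blast
  then obtain c where c: "c \<notin> (\<Union>v\<in>Z. {x. poly (P v) x = 0})"
    using infinite_alg_closed ex_new_if_finite by blast
  define b where "b = comb s d c l F"
  have b: "b \<in> forms m (int (d l))"
    unfolding b_def using lm ms sorted F by (intro comb_forms) auto
  let ?a = "a(l := b)" and ?e = "e(l := int (d l))"
  \<comment> \<open>The binary forms stay in the enlarged ideal, and by the choice of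
    \<open>c\<close> no point of \<open>Z\<close> is a zero of \<open>b\<close>, so the
    Nullstellensatz yields the power needed for the exchange.\<close>
  have "\<exists>k. var l ^ Suc k \<in> hideal m {..<m} ?a ?e (int (Suc k))"
  proof (rule power_in_hideal)
    show "?e i \<ge> 0" for i by (simp add: e_def)
    show "?a i \<in> forms m (?e i)" if "i \<in> {..<m}" for i using that af b by auto
    show "\<exists>p n. p \<noteq> 0 \<and> degree p \<le> n \<and> bform n p (var i) (var l) \<in> hideal m {..<m} ?a ?e (int n)" if "i < m" for i
    proof -
      have "hideal m J a e n = hideal m J ?a ?e n" for n using J(2) by (intro hideal_cong) auto
      then show ?thesis using bf[OF that] hideal_insert_subset[OF J(1,2), of _ m ?a ?e] unfolding J(3) by metis
    qed
    fix v assume v: "v l = 1" "\<And>i. i \<ge> m \<Longrightarrow> v i = (0::'a)"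
    show "\<exists>i\<in>{..<m}. meval (?a i) v \<noteq> 0"
    proof (rule ccontr)
      assume no: "\<not> ?thesis"
      then have "meval (a i) v = 0" if "i \<in> J" for i using that by (auto simp: J_def split: if_splits)
      then have "v \<in> Z" using v by (simp add: Z_def)
      then have "poly (P v) c \<noteq> 0" using c by blast
      moreover have "poly (P v) c = meval b v"
        by (simp add: P_def b_def meval_comb v poly_sum poly_monom mult.commute)
      moreover have "meval (?a l) v = 0" using no lm by blast
      ultimately show False by simp
    qed
  qed (use lm in simp_all)
  then obtain k where pow: "a l ^ Suc k \<in> hideal m (insert l J) ?a ?e (int (Suc k) * e l)"
    unfolding J(3) by (auto simp: al)
  have e1: "1 \<le> e l" and e0: "\<And>i. i \<in> J \<Longrightarrow> 0 \<le> e i"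
    by (simp_all add: e_def)
  have af': "\<And>i. i \<in> insert l J \<Longrightarrow> a i \<in> forms m (e i)"
    using af unfolding J(3) by simp
  note ex = exchange[OF J(1,2) K e1 e0 af' dual b pow, unfolded J(3)]
  have a': "?a = (\<lambda>i. if i < Suc l then comb s d ((\<kappa>(l := c)) i) i F else var i)"
    and e': "?e = (\<lambda>i. if i < Suc l then int (d i) else 1)"
    by (auto simp: a_def e_def b_def)
  have \<sigma>': "\<sigma> - e l + int (d l) = (\<Sum>i<Suc l. int (d i) - 1)" by (simp add: \<sigma>_def al)
  from ex show ?case unfolding a' e' \<sigma>' by blast
qed

subsection \<open>Affine ideals with regular top forms\<close>

lemma gen_ideal_eq: "gen_ideal m s g = {\<Sum>i<s. q i * g i | q. \<forall>i<s. q i \<in> supp_in (exps m)}"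
  by (simp add: gen_ideal_def polys_eq)

lemma gen_idealI: "(\<And>i. i < s \<Longrightarrow> q i \<in> supp_in (exps m)) \<Longrightarrow> (\<Sum>i<s. q i * g i) \<in> gen_ideal m s g"
  unfolding gen_ideal_eq by blast

lemma gen_ideal_0: "0 \<in> gen_ideal m s g"
  using gen_idealI[of s "\<lambda>_. 0"] by simp

lemma gen_ideal_add:
  assumes "x \<in> gen_ideal m s g" "y \<in> gen_ideal m s g"
  shows "x + y \<in> gen_ideal m s g"
proof -
  obtain q r where "x = (\<Sum>i<s. q i * g i)" "y = (\<Sum>i<s. r i * g i)"
    "\<forall>i<s. q i \<in> supp_in (exps m)" "\<forall>i<s. r i \<in> supp_in (exps m)"
    using assms unfolding gen_ideal_eq by blast
  then show ?thesis
    using gen_idealI[of s "\<lambda>i. q i + r i" m g] by (auto simp: distrib_right sum.distrib)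
qed

lemma gen_ideal_mult:
  assumes "x \<in> gen_ideal m s g" "p \<in> supp_in (exps m)"
  shows "p * x \<in> gen_ideal m s g"
proof -
  obtain q where "x = (\<Sum>i<s. q i * g i)" "\<forall>i<s. q i \<in> supp_in (exps m)"
    using assms unfolding gen_ideal_eq by blast
  then show ?thesis
    using gen_idealI[of s "\<lambda>i. p * q i" m g] polys_mult[OF assms(2)] by (simp add: sum_distrib_left mult.assoc)
qed

lemma mconst_polys: "mconst c \<in> supp_in (exps m)"
  using mconst_forms exps_eq_exps by (rule supp_in_mono)

lemma gen_ideal_uminus: "x \<in> gen_ideal m s g \<Longrightarrow> - x \<in> gen_ideal m s g"
  using gen_ideal_mult[OF _ mconst_polys, of x m s g "- 1"] by (simp add: mconst_minus)

lemma gen_ideal_diff: "x \<in> gen_ideal m s g \<Longrightarrow> y \<in> gen_ideal m s g \<Longrightarrow> x - y \<in> gen_ideal m s g"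
  using gen_ideal_add[of x m s g "- y"] gen_ideal_uminus[of y m s g] by simp

lemma gen_ideal_sum: "(\<And>k. k \<in> K \<Longrightarrow> h k \<in> gen_ideal m s g) \<Longrightarrow> (\<Sum>k\<in>K. h k) \<in> gen_ideal m s g"
  by (induction K rule: infinite_finite_induct) (auto intro: gen_ideal_0 gen_ideal_add)

lemma gen_ideal_generator:
  assumes "i < s"
  shows "g i \<in> gen_ideal m s g"
proof -
  have "(\<Sum>k<s. (if k = i then 1 else 0) * g k) \<in> gen_ideal m s g"
    using mconst_polys[of 1 m] by (intro gen_idealI) auto
  then show ?thesis using assms by (simp add: if_distrib[of "\<lambda>x. x * _"] cong: if_cong)
qed

lemma polys_bounded:
  assumes "p \<in> supp_in (exps m)"
  obtains n where "p \<in> supp_in (exps_le m (int n))"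
proof
  have "monom_deg \<alpha> \<le> Max (insert 0 (monom_deg ` mkeys p))" if "\<alpha> \<in> mkeys p" for \<alpha>
    using that by (intro Max_ge) auto
  then show "p \<in> supp_in (exps_le m (int (Max (insert 0 (monom_deg ` mkeys p)))))"
    using assms unfolding supp_in_def exps_le_def by auto
qed

text \<open>Off-diagonal terms cancel in pairs; the diagonal is assumed to vanish because of
  characteristic two.\<close>

lemma antisym_double_sum:
  fixes w :: "'i \<Rightarrow> 'i \<Rightarrow> 'r::comm_ring_1"
  assumes "finite I" "\<And>i k. i \<in> I \<Longrightarrow> k \<in> I \<Longrightarrow> w i k = - w k i" "\<And>i. i \<in> I \<Longrightarrow> w i i = 0"
  shows "(\<Sum>i\<in>I. (\<Sum>k\<in>I. w i k * x k) * x i) = 0"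
  using assms
proof (induction I rule: finite_induct)
  case (insert j I)
  have "(\<Sum>i\<in>I. w i j * x j * x i) = (\<Sum>i\<in>I. - (w j i * x i * x j))"
  proof (rule sum.cong)
    fix i assume "i \<in> I"
    then have "w i j = - w j i" using insert.prems(1)[of i j] by simp
    then show "w i j * x j * x i = - (w j i * x i * x j)" by (simp add: mult_ac)
  qed simp
  moreover have "w j j = 0" using insert.prems(2)[of j] by blast
  moreover have "(\<Sum>i\<in>I. (\<Sum>k\<in>I. w i k * x k) * x i) = 0"
    by (rule insert.IH) (use insert.prems in blast)+
  ultimately show ?case
    using insert.hyps by (simp add: distrib_right sum.distrib sum_negf sum_distrib_right)
qed simp

text \<open>Setting for transferring graded properties of the top forms \<open>b\<close> to the
  affine ideal of \<open>g\<close>, in the manner of a standard basis for the degree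
  filtration.\<close>

locale regular_top =
  fixes m :: nat and g :: "nat \<Rightarrow> 'a::field mpoly" and e :: "nat \<Rightarrow> int" and b :: "nat \<Rightarrow> 'a mpoly"
    and \<sigma> :: int and \<phi> :: "'a mpoly \<Rightarrow> 'a"
  assumes g: "\<And>i. i < m \<Longrightarrow> g i \<in> supp_in (exps_le m (e i))"
    and b: "\<And>i. i < m \<Longrightarrow> b i = restr (exps_eq m (e i)) (g i)"
    and K: "koszul m {..<m} b e"
    and dual: "dualizing m {..<m} b e \<sigma> \<phi>"
begin

lemma g_minus_b: "i < m \<Longrightarrow> g i - b i \<in> supp_in (exps_le m (e i - 1))"
  using diff_restr_supp_in[OF g, of i "exps_eq m (e i)"] by (simp add: b exps_le_diff_eq)

lemma form_mult_lower:
  assumes "q \<in> forms m (c - e i)" "i < m"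
  shows "q * (g i - b i) \<in> supp_in (exps_le m (c - 1))"
  using supp_le_mult[OF supp_in_mono[OF assms(1) exps_eq_le] g_minus_b[OF assms(2)]] by (simp add: algebra_simps)

text \<open>If the coefficients exceed the expected degree, their top components form a syzygy of
  \<open>b\<close>, hence a Koszul one. The same antisymmetric matrix applied to \<open>g\<close>
  gives a relation of \<open>g\<close>; subtracting it keeps the sum and lowers the degree bound by
  one.\<close>

lemma ideal_degree_le:
  assumes "p \<in> gen_ideal m m g" and p: "p \<in> supp_in (exps_le m k)"
  shows "\<exists>q. (\<forall>i<m. q i \<in> supp_in (exps_le m (k - e i))) \<and> p = (\<Sum>i<m. q i * g i)"
proof -
  have lower: "\<exists>q. (\<forall>i<m. q i \<in> supp_in (exps_le m (k - e i))) \<and> p = (\<Sum>i<m. q i * g i)"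
    if "\<forall>i<m. q i \<in> supp_in (exps_le m (k + int t - e i))" "p = (\<Sum>i<m. q i * g i)" for q t
    using that
  proof (induction t arbitrary: q)
    case (Suc t)
    define D where "D = k + int (Suc t)"
    have q: "q i \<in> supp_in (exps_le m (D - e i))" if "i < m" for i using Suc.prems that by (simp add: D_def)
    define u where "u i = restr (exps_eq m (D - e i)) (q i)" for i
    have uf: "u i \<in> forms m (D - e i)" for i by (simp add: u_def)
    have "restr (exps_eq m D) (q i * g i) = u i * b i" if "i < m" for i
      using top_form_mult[OF q[OF that] g[OF that]] by (simp add: u_def b[OF that])
    then have "(\<Sum>i<m. u i * b i) = restr (exps_eq m D) p"
      unfolding Suc.prems(2) restr_sum by simp
    also have "\<dots> = 0" using p by (rule restr_eq_0) (auto simp: exps_eq_def exps_le_def D_def)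
    finally have "(\<Sum>i<m. u i * b i) = 0" .
    then obtain w where w: "\<forall>i\<in>{..<m}. \<forall>k\<in>{..<m}. w i k \<in> forms m (D - e i - e k)"
      "\<forall>i\<in>{..<m}. \<forall>k\<in>{..<m}. w i k = - w k i" "\<forall>i\<in>{..<m}. w i i = 0"
      "\<forall>i\<in>{..<m}. u i = (\<Sum>k<m. w i k * b k)"
      using koszulD[OF K uf] by blast
    define q' where "q' i = q i - (\<Sum>k<m. w i k * g k)" for i
    show ?case
    proof (rule Suc.IH[of q'])
      have "(\<Sum>i<m. (\<Sum>k<m. w i k * g k) * g i) = 0"
        by (rule antisym_double_sum) (use w(2,3) in blast)+
      then show "p = (\<Sum>i<m. q' i * g i)"
        unfolding Suc.prems(2) by (simp add: q'_def left_diff_distrib sum_subtractf)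
      show "\<forall>i<m. q' i \<in> supp_in (exps_le m (k + int t - e i))"
      proof (intro allI impI)
        fix i assume i: "i < m"
        \<comment> \<open>The top part \<open>u i\<close> cancels against the matrix applied to
          \<open>b\<close>; only lower terms of \<open>q i\<close> and of the \<open>g k\<close>
          remain.\<close>
        have q'i: "q' i = (q i - u i) - (\<Sum>k<m. w i k * (g k - b k))"
          using w(4) i by (simp add: q'_def right_diff_distrib sum_subtractf)
        have qu: "q i - u i \<in> supp_in (exps_le m (D - e i - 1))"
          using diff_restr_supp_in[OF q[OF i], of "exps_eq m (D - e i)"] by (simp add: u_def exps_le_diff_eq)
        have "w i k * (g k - b k) \<in> supp_in (exps_le m (D - e i - 1))" if "k < m" for k
          using w(1) i that by (intro form_mult_lower) auto
        then have wg: "(\<Sum>k<m. w i k * (g k - b k)) \<in> supp_in (exps_le m (D - e i - 1))"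
          by (intro supp_in_sum) auto
        have "q' i \<in> supp_in (exps_le m (D - e i - 1))" unfolding q'i using qu wg by (rule supp_in_diff)
        then show "q' i \<in> supp_in (exps_le m (k + int t - e i))" by (simp add: D_def algebra_simps)
      qed
    qed
  qed auto
  obtain q where q: "\<forall>i<m. q i \<in> supp_in (exps m)" "p = (\<Sum>i<m. q i * g i)"
    using assms(1) unfolding gen_ideal_eq by blast
  have "\<forall>i<m. \<exists>n. q i \<in> supp_in (exps_le m (int n))" using q(1) polys_bounded by metis
  then obtain n where n: "\<And>i. i < m \<Longrightarrow> q i \<in> supp_in (exps_le m (int (n i)))" by metis
  \<comment> \<open>A crude bound that dominates the excess of every single coefficient.\<close>
  define t where "t = (\<Sum>i<m. nat (int (n i) + e i - k))"
  have "q i \<in> supp_in (exps_le m (k + int t - e i))" if "i < m" for i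
  proof -
    have "nat (int (n i) + e i - k) \<le> t" unfolding t_def using that by (intro member_le_sum) auto
    then have "int (n i) \<le> k + int t - e i" by linarith
    then show ?thesis by (rule supp_in_mono[OF n[OF that] exps_le_mono])
  qed
  then show ?thesis using lower q(2) by blast
qed

text \<open>Once the coefficients have controlled degree, the component of degree \<open>k\<close>
  can be computed summand by summand.\<close>

lemma top_in_hideal:
  assumes "p \<in> gen_ideal m m g" "p \<in> supp_in (exps_le m k)"
  shows "restr (exps_eq m k) p \<in> hideal m {..<m} b e k"
proof -
  obtain q where q: "\<forall>i<m. q i \<in> supp_in (exps_le m (k - e i))" "p = (\<Sum>i<m. q i * g i)"
    using ideal_degree_le[OF assms] by blast
  have "restr (exps_eq m k) (q i * g i) = restr (exps_eq m (k - e i)) (q i) * b i" if "i < m" for i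
    using top_form_mult[OF q(1)[rule_format, OF that] g[OF that]] by (simp add: b[OF that])
  then show ?thesis
    unfolding q(2) restr_sum by (intro hidealI[where q = "\<lambda>i. restr (exps_eq m (k - e i)) (q i)"]) auto
qed

text \<open>Writing the top component through \<open>b\<close> and then replacing \<open>b\<close>
  by \<open>g\<close> affects lower degrees only.\<close>

lemma reduce_top:
  assumes p: "p \<in> supp_in (exps_le m D)" and top: "restr (exps_eq m D) p \<in> hideal m {..<m} b e D"
  shows "\<exists>x\<in>gen_ideal m m g. p - x \<in> supp_in (exps_le m (D - 1))"
proof -
  obtain q where q: "restr (exps_eq m D) p = (\<Sum>i<m. q i * b i)" "\<And>i. i < m \<Longrightarrow> q i \<in> forms m (D - e i)"
    using top by (auto elim: hidealE)
  have eq: "p - (\<Sum>i<m. q i * g i) = (p - restr (exps_eq m D) p) - (\<Sum>i<m. q i * (g i - b i))"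
    by (simp add: q(1) right_diff_distrib sum_subtractf)
  have pr: "p - restr (exps_eq m D) p \<in> supp_in (exps_le m (D - 1))"
    using diff_restr_supp_in[OF p, of "exps_eq m D"] by (simp add: exps_le_diff_eq)
  have qgb: "(\<Sum>i<m. q i * (g i - b i)) \<in> supp_in (exps_le m (D - 1))"
    using q(2) by (intro supp_in_sum form_mult_lower) auto
  have "p - (\<Sum>i<m. q i * g i) \<in> supp_in (exps_le m (D - 1))" unfolding eq using pr qgb by (rule supp_in_diff)
  moreover have "(\<Sum>i<m. q i * g i) \<in> gen_ideal m m g"
    by (intro gen_idealI supp_in_mono[OF q(2) exps_eq_exps])
  ultimately show ?thesis by blast
qed

text \<open>Above degree \<sigma> every form lies in the graded ideal, so top components can be
  removed until degree \<sigma> is reached.\<close>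

lemma reduce_degree:
  assumes "p \<in> supp_in (exps m)"
  shows "\<exists>p'\<in>supp_in (exps_le m \<sigma>). p - p' \<in> gen_ideal m m g"
proof -
  have *: "\<exists>p'\<in>supp_in (exps_le m \<sigma>). p - p' \<in> gen_ideal m m g" if "p \<in> supp_in (exps_le m (\<sigma> + int t))" for p t
    using that
  proof (induction t arbitrary: p)
    case 0
    then show ?case by (intro bexI[of _ p]) (auto intro: gen_ideal_0)
  next
    case (Suc t)
    have "restr (exps_eq m (\<sigma> + int (Suc t))) p \<in> hideal m {..<m} b e (\<sigma> + int (Suc t))"
      by (rule dualizing_high_degree[OF dual]) auto
    then obtain x where x: "x \<in> gen_ideal m m g" "p - x \<in> supp_in (exps_le m (\<sigma> + int t))"
      using reduce_top[OF Suc.prems] by auto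
    then obtain p' where p': "p' \<in> supp_in (exps_le m \<sigma>)" "p - x - p' \<in> gen_ideal m m g"
      using Suc.IH by blast
    then have "(p - x - p') + x \<in> gen_ideal m m g" using x gen_ideal_add by blast
    then show ?case using p'(1) by (intro bexI[of _ p']) (simp_all add: algebra_simps)
  qed
  obtain n where "p \<in> supp_in (exps_le m (int n))" using assms by (rule polys_bounded)
  then have "p \<in> supp_in (exps_le m (\<sigma> + int (nat (int n - \<sigma>))))"
    by (rule supp_in_mono) (rule exps_le_mono, simp)
  then show ?thesis by (rule *)
qed

text \<open>The functional reduces a polynomial to degree at most \<sigma>, takes the component of
  degree \<sigma> and applies \<phi>. Nondegeneracy is inherited from the top forms by descent on
  the degree.\<close>

lemma gorenstein: "gorenstein_quotient m (gen_ideal m m g)"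
proof -
  let ?I = "gen_ideal m m g"
  interpret vs: vector_space "mscale :: 'a \<Rightarrow> 'a mpoly \<Rightarrow> 'a mpoly"
    by (rule vector_space_mscale)
  have lin: "islin \<phi>" using dual by (simp add: dualizing_def)
  define B where "B = (\<lambda>\<alpha>. Poly_Mapping.single \<alpha> (1::'a)) ` exps_le m \<sigma>"
  have span: "p \<in> vs.span B" if "p \<in> supp_in (exps_le m \<sigma>)" for p
  proof -
    have "mkeys p \<subseteq> exps_le m \<sigma>" using that by (simp add: supp_in_def)
    then show ?thesis
    proof (induction p rule: mpoly_induct)
      case (single \<alpha> c)
      then have "mscale c (Poly_Mapping.single \<alpha> 1) \<in> vs.span B"
        by (intro vs.span_scale vs.span_base) (auto simp: B_def)
      moreover have "mscale c (Poly_Mapping.single \<alpha> 1) = Poly_Mapping.single \<alpha> c"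
        by (simp add: mscale_def mconst_def mult_single)
      ultimately show ?case by simp
    qed (auto intro: vs.span_zero vs.span_add)
  qed
  have 1: "finite B" "B \<subseteq> polys m" "\<forall>p\<in>polys m. \<exists>q\<in>vs.span B. p - q \<in> ?I"
  proof -
    show "finite B" by (simp add: B_def finite_exps_le)
    show "B \<subseteq> polys m" using exps_le_exps[of m \<sigma>] by (auto simp: B_def polys_eq)
    show "\<forall>p\<in>polys m. \<exists>q\<in>vs.span B. p - q \<in> ?I" using reduce_degree span unfolding polys_eq by blast
  qed
  define R where "R p p' \<longleftrightarrow> p' \<in> supp_in (exps_le m \<sigma>) \<and> p - p' \<in> ?I" for p p'
  define L where "L p = \<phi> (restr (exps_eq m \<sigma>) (SOME p'. R p p'))" for p
  \<comment> \<open>Two reductions differ by an ideal element of degree at most \<sigma>, whose top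
    component lies in the graded ideal and is killed by \<phi>.\<close>
  have uniq: "\<phi> (restr (exps_eq m \<sigma>) p') = \<phi> (restr (exps_eq m \<sigma>) p'')" if "R p p'" "R p p''" for p p' p''
  proof -
    have "(p - p'') - (p - p') \<in> ?I" using that unfolding R_def by (metis gen_ideal_diff)
    moreover have "p' - p'' \<in> supp_in (exps_le m \<sigma>)" using that by (auto simp: R_def)
    ultimately have "restr (exps_eq m \<sigma>) (p' - p'') \<in> hideal m {..<m} b e \<sigma>"
      by (intro top_in_hideal) auto
    then have "\<phi> (restr (exps_eq m \<sigma>) (p' - p'')) = 0" using dual by (simp add: dualizing_def)
    then show ?thesis by (simp add: restr_diff islin_diff[OF lin])
  qed
  have L: "L p = \<phi> (restr (exps_eq m \<sigma>) p')" if "R p p'" for p p'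
    unfolding L_def using that uniq by (metis someI_ex)
  have exR: "\<exists>p'. R p p'" if "p \<in> supp_in (exps m)" for p
    using reduce_degree[OF that] by (auto simp: R_def)
  have L_add: "L (p + q) = L p + L q" if pq: "p \<in> supp_in (exps m)" "q \<in> supp_in (exps m)" for p q
  proof -
    obtain p' q' where R: "R p p'" "R q q'" using exR[OF pq(1)] exR[OF pq(2)] by blast
    have "(p - p') + (q - q') \<in> ?I" using R unfolding R_def by (metis gen_ideal_add)
    then have "R (p + q) (p' + q')" using R by (auto simp: R_def algebra_simps)
    then show ?thesis using L R by (simp add: restr_add islin_add[OF lin])
  qed
  have L_scale: "L (mscale c p) = c * L p" if p: "p \<in> supp_in (exps m)" for c p
  proof -
    obtain p' where R: "R p p'" using exR[OF p] by blast
    have "mconst c * (p - p') \<in> ?I" using R mconst_polys gen_ideal_mult unfolding R_def by blast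
    then have "mscale c p - mscale c p' \<in> ?I" by (simp add: mscale_def right_diff_distrib)
    then have "R (mscale c p) (mscale c p')" using R by (auto simp: R_def intro: mscale_supp_in)
    then show ?thesis using L R by (simp add: restr_mscale islin_mscale[OF lin])
  qed
  have L_I: "L p = 0" if "p \<in> ?I" for p
    using L[of p 0] that islin_0[OF lin] by (simp add: R_def)
  have L_le: "L p = \<phi> (restr (exps_eq m \<sigma>) p)" if "p \<in> supp_in (exps_le m \<sigma>)" for p
    using L[of p p] that by (simp add: R_def gen_ideal_0)
  \<comment> \<open>The bound \<open>int t - 1\<close> lets the induction start at the zero
    polynomial.\<close>
  have nondeg: "a \<in> ?I" if "a \<in> supp_in (exps_le m (int t - 1))" "\<And>c. c \<in> supp_in (exps m) \<Longrightarrow> L (a * c) = 0" for a t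
    using that
  proof (induction t arbitrary: a)
    case 0
    have "supp_in (exps_le m (- 1)) = ({0} :: 'a mpoly set)" by (rule supp_le_neg) simp
    then have "a = 0" using 0 by auto
    then show ?case by (simp add: gen_ideal_0)
  next
    case (Suc t)
    have a: "a \<in> supp_in (exps_le m (int t))" using Suc.prems(1) by simp
    let ?u = "restr (exps_eq m (int t)) a"
    \<comment> \<open>A multiplier that is homogeneous of degree \<open>\<sigma> - int t\<close>
      makes \<open>L\<close> see the top component of \<open>a\<close> only.\<close>
    have "\<phi> (?u * v) = 0" if v: "v \<in> forms m (\<sigma> - int t)" for v
    proof -
      have v': "v \<in> supp_in (exps_le m (\<sigma> - int t))" using v exps_eq_le by (rule supp_in_mono)
      have "a * v \<in> supp_in (exps_le m \<sigma>)" using supp_le_mult[OF a v'] by simp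
      then have "L (a * v) = \<phi> (restr (exps_eq m \<sigma>) (a * v))" by (rule L_le)
      also have "restr (exps_eq m \<sigma>) (a * v) = ?u * v" using top_form_mult[OF a v'] v by (simp add: restr_eq)
      finally show ?thesis using Suc.prems(2)[OF supp_in_mono[OF v exps_eq_exps]] by simp
    qed
    then have "?u \<in> hideal m {..<m} b e (int t)" using dual unfolding dualizing_def by auto
    then obtain x where x: "x \<in> ?I" "a - x \<in> supp_in (exps_le m (int t - 1))"
      using reduce_top[OF a] by blast
    \<comment> \<open>Subtracting the ideal element \<open>x\<close> does not change the values of
      \<open>L\<close> on multiples, so the induction hypothesis applies.\<close>
    have "a - x \<in> ?I"
    proof (rule Suc.IH[OF x(2)])
      fix c :: "'a mpoly" assume c: "c \<in> supp_in (exps m)"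
      have "c * x \<in> ?I" using x(1) c by (rule gen_ideal_mult)
      then have "L (x * c) = 0" using L_I by (simp add: mult.commute)
      moreover have "(a - x) * c \<in> supp_in (exps m)"
        by (rule polys_mult[OF supp_in_mono[OF x(2) exps_le_exps] c])
      moreover have "x * c \<in> supp_in (exps m)"
      proof -
        have "a - (a - x) \<in> supp_in (exps m)"
          by (rule supp_in_diff[OF supp_in_mono[OF a exps_le_exps] supp_in_mono[OF x(2) exps_le_exps]])
        then have "x \<in> supp_in (exps m)" by simp
        then show ?thesis using c by (rule polys_mult)
      qed
      ultimately have "L ((a - x) * c + x * c) = L ((a - x) * c)" using L_add by simp
      moreover have "(a - x) * c + x * c = a * c" by (simp add: algebra_simps)
      ultimately show "L ((a - x) * c) = 0" using Suc.prems(2)[OF c] by simp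
    qed
    then have "(a - x) + x \<in> ?I" using x(1) by (rule gen_ideal_add)
    then show ?case by simp
  qed
  have "a \<in> ?I" if a: "a \<in> polys m" "\<forall>c\<in>polys m. L (a * c) = 0" for a
  proof -
    obtain n where "a \<in> supp_in (exps_le m (int n))" using a unfolding polys_eq by (auto elim: polys_bounded)
    then have "a \<in> supp_in (exps_le m (int (Suc n) - 1))" by simp
    then show ?thesis by (rule nondeg) (use a(2) in \<open>simp add: polys_eq\<close>)
  qed
  then show ?thesis
    unfolding gorenstein_quotient_def using 1 L_add L_scale L_I
    by (intro conjI exI[of _ B] exI[of _ L]) (auto simp: polys_eq)
qed

end

subsection \<open>Truncated ideals\<close>

text \<open>With the last coordinate 0, a term survives homogenization only if its padding exponent
  is 0, where \<open>0 ^ 0 = 1\<close>; these are the terms of top degree.\<close>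

lemma meval_homogenize_at_infinity:
  assumes p: "p \<in> polys m" "p \<noteq> 0" and v: "v m = 0"
  shows "meval (homogenize m p) v = meval (restr (exps_eq m (int (mdeg p))) p) v"
proof -
  let ?r = "restr (exps_eq m (int (mdeg p))) p"
  have "meval (homogenize m p) v = (\<Sum>\<alpha>\<in>mkeys p. lkup p \<alpha> * (mon_eval \<alpha> v * 0 ^ (mdeg p - monom_deg \<alpha>)))"
    by (simp add: homogenize_def meval_sum mon_eval_add v)
  also have "\<dots> = (\<Sum>\<alpha>\<in>mkeys p. lkup ?r \<alpha> * mon_eval \<alpha> v)"
  proof (rule sum.cong)
    fix \<alpha> assume \<alpha>: "\<alpha> \<in> mkeys p"
    then have "\<alpha> \<in> exps m" using p(1) by (auto simp: polys_eq supp_in_def)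
    moreover have "monom_deg \<alpha> \<le> mdeg p" using mdeg_le_iff[OF p(2), of "mdeg p"] \<alpha> by blast
    ultimately show "lkup p \<alpha> * (mon_eval \<alpha> v * 0 ^ (mdeg p - monom_deg \<alpha>)) = lkup ?r \<alpha> * mon_eval \<alpha> v"
      by (cases "monom_deg \<alpha> = mdeg p") (auto simp: restr.rep_eq exps_eq_def power_0_left)
  qed simp
  also have "\<dots> = meval ?r v"
    by (rule meval_superset[symmetric]) (auto simp: in_keys_iff restr.rep_eq)
  finally show ?thesis .
qed

lemma trunc_ideal_eq:
  "trunc_ideal m s f k = {\<Sum>i<s. q i * f i | q. \<forall>i<s. q i \<in> supp_in (exps_le m (k - int (mdeg (f i))))}"
  by (simp add: trunc_ideal_def polys_le_eq)

lemma trunc_ideal_term: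
  assumes "l < s" "q \<in> supp_in (exps_le m (k - int (mdeg (f l))))"
  shows "q * f l \<in> trunc_ideal m s f k"
proof -
  have "q * f l = (\<Sum>i<s. (if i = l then q else 0) * f i)"
    using assms(1) by (simp add: if_distrib[of "\<lambda>x. x * _"] cong: if_cong)
  moreover have "\<forall>i<s. (if i = l then q else 0) \<in> supp_in (exps_le m (k - int (mdeg (f i))))"
    using assms(2) by auto
  ultimately show ?thesis
    unfolding trunc_ideal_eq by (intro CollectI exI[of _ "\<lambda>i. if i = l then q else 0"] conjI)
qed

lemma trunc_ideal_add:
  assumes "x \<in> trunc_ideal m s f k" "y \<in> trunc_ideal m s f k"
  shows "x + y \<in> trunc_ideal m s f k"
proof -
  obtain q r where q: "x = (\<Sum>i<s. q i * f i)" "\<forall>i<s. q i \<in> supp_in (exps_le m (k - int (mdeg (f i))))"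
    and r: "y = (\<Sum>i<s. r i * f i)" "\<forall>i<s. r i \<in> supp_in (exps_le m (k - int (mdeg (f i))))"
    using assms unfolding trunc_ideal_eq by blast
  have "x + y = (\<Sum>i<s. (q i + r i) * f i)" by (simp add: q r distrib_right sum.distrib)
  moreover have "\<forall>i<s. q i + r i \<in> supp_in (exps_le m (k - int (mdeg (f i))))" using q r by auto
  ultimately show ?thesis unfolding trunc_ideal_eq by (intro CollectI exI[of _ "\<lambda>i. q i + r i"]) simp
qed

lemma trunc_ideal_0: "0 \<in> trunc_ideal m s f k"
  unfolding trunc_ideal_eq by (intro CollectI exI[of _ "\<lambda>_. 0"]) auto

lemma trunc_ideal_sum: "(\<And>i. i \<in> I \<Longrightarrow> h i \<in> trunc_ideal m s f k) \<Longrightarrow> (\<Sum>i\<in>I. h i) \<in> trunc_ideal m s f k"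
  by (induction I rule: infinite_finite_induct) (auto intro: trunc_ideal_0 trunc_ideal_add)

lemma trunc_ideal_mono:
  assumes "k \<le> k'"
  shows "trunc_ideal m s f k \<subseteq> trunc_ideal m s f k'"
proof
  fix x assume "x \<in> trunc_ideal m s f k"
  then obtain q where q: "x = (\<Sum>i<s. q i * f i)" "\<forall>i<s. q i \<in> supp_in (exps_le m (k - int (mdeg (f i))))"
    unfolding trunc_ideal_eq by blast
  have "q i \<in> supp_in (exps_le m (k' - int (mdeg (f i))))" if "i < s" for i
    by (rule supp_in_mono[OF q(2)[rule_format, OF that] exps_le_mono]) (use assms in simp)
  then show "x \<in> trunc_ideal m s f k'" unfolding trunc_ideal_eq q(1) by blast
qed

lemma trunc_ideal_subset_gen: "trunc_ideal m s f k \<subseteq> gen_ideal m s f"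
proof
  fix x assume "x \<in> trunc_ideal m s f k"
  then obtain q where q: "x = (\<Sum>i<s. q i * f i)" "\<forall>i<s. q i \<in> supp_in (exps_le m (k - int (mdeg (f i))))"
    unfolding trunc_ideal_eq by blast
  show "x \<in> gen_ideal m s f"
    unfolding q(1) by (intro gen_idealI supp_in_mono[OF q(2)[rule_format] exps_le_exps])
qed

text \<open>The truncated ideals increase with the degree bound and stay inside the full ideal; if
  the full ideal adds nothing in degree at most \<open>k\<close>, all the intersections
  coincide.\<close>

lemma cond_starI:
  assumes "gen_ideal m s f \<inter> polys_le m k \<subseteq> trunc_ideal m s f k"
  shows "cond_star m s f k k"
  unfolding cond_star_def
proof (intro allI impI)
  fix d assume "k \<le> d"
  then have "trunc_ideal m s f d \<inter> polys_le m k = trunc_ideal m s f k \<inter> polys_le m k"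
    using assms trunc_ideal_mono trunc_ideal_subset_gen by blast
  then show "quot_dim (polys_le m k) (trunc_ideal m s f k \<inter> polys_le m k)
           = quot_dim (polys_le m k) (trunc_ideal m s f d \<inter> polys_le m k)" by simp
qed

section \<open>Passing between the generators and their triangular combinations\<close>

lemma gen_ideal_comb_subset:
  assumes "m \<le> s"
  shows "gen_ideal m m (\<lambda>i. comb s d (\<kappa> i) i f) \<subseteq> gen_ideal m s f"
proof
  fix x assume "x \<in> gen_ideal m m (\<lambda>i. comb s d (\<kappa> i) i f)"
  then obtain q where q: "x = (\<Sum>i<m. q i * comb s d (\<kappa> i) i f)" "\<forall>i<m. q i \<in> supp_in (exps m)"
    unfolding gen_ideal_eq by blast
  have "comb s d (\<kappa> i) i f \<in> gen_ideal m s f" if "i < m" for i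
    unfolding comb_def
  proof (rule gen_ideal_sum)
    fix l assume l: "l \<in> {i..<s}"
    have "mconst (\<kappa> i ^ (l - i)) * var i ^ (d i - d l) \<in> supp_in (exps m)"
      by (intro polys_mult mconst_polys supp_in_mono[OF forms_power[OF var_forms[OF that]] exps_eq_exps])
    then show "mconst (\<kappa> i ^ (l - i)) * var i ^ (d i - d l) * f l \<in> gen_ideal m s f"
      using l by (intro gen_ideal_mult gen_ideal_generator) auto
  qed
  then show "x \<in> gen_ideal m s f" unfolding q(1) using q(2) by (intro gen_ideal_sum gen_ideal_mult) auto
qed

text \<open>By unitriangularity \<open>f n\<close> is the combination at \<open>n\<close> minus
  multiples of later \<open>f l\<close>. Downward induction puts all generators into the set
  \<open>M\<close> of decomposable elements, which is closed under sums and multiples.\<close>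

lemma gen_ideal_decompose:
  fixes f :: "nat \<Rightarrow> 'a::field mpoly"
  assumes ms: "m \<le> s" and x: "x \<in> gen_ideal m s f"
  shows "\<exists>y\<in>gen_ideal m m (\<lambda>i. comb s d (\<kappa> i) i f). \<exists>r. (\<forall>l. r l \<in> supp_in (exps m)) \<and> x = y + (\<Sum>l\<in>{m..<s}. r l * f l)"
proof -
  let ?G = "gen_ideal m m (\<lambda>i. comb s d (\<kappa> i) i f)"
  define M where "M = {x. \<exists>y\<in>?G. \<exists>r. (\<forall>l. r l \<in> supp_in (exps m)) \<and> x = y + (\<Sum>l\<in>{m..<s}. r l * f l)}"
  have M_I: "y + (\<Sum>l\<in>{m..<s}. r l * f l) \<in> M" if "y \<in> ?G" "\<And>l. r l \<in> supp_in (exps m)" for y r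
    using that by (auto simp: M_def)
  have M_add: "x + y \<in> M" if xy: "x \<in> M" "y \<in> M" for x y
  proof -
    obtain x' r y' t where *: "x' \<in> ?G" "\<And>l. r l \<in> supp_in (exps m)" "x = x' + (\<Sum>l\<in>{m..<s}. r l * f l)"
      "y' \<in> ?G" "\<And>l. t l \<in> supp_in (exps m)" "y = y' + (\<Sum>l\<in>{m..<s}. t l * f l)"
      using xy unfolding M_def by blast
    have "x' + y' + (\<Sum>l\<in>{m..<s}. (r l + t l) * f l) \<in> M"
      using * by (intro M_I gen_ideal_add supp_in_add) auto
    then show ?thesis by (simp add: * distrib_right sum.distrib algebra_simps)
  qed
  have M_mult: "p * x \<in> M" if xp: "x \<in> M" "p \<in> supp_in (exps m)" for x p
  proof -
    obtain x' r where *: "x' \<in> ?G" "\<And>l. r l \<in> supp_in (exps m)" "x = x' + (\<Sum>l\<in>{m..<s}. r l * f l)"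
      using xp unfolding M_def by blast
    have "p * x' + (\<Sum>l\<in>{m..<s}. (p * r l) * f l) \<in> M"
      using * xp by (intro M_I gen_ideal_mult polys_mult) auto
    then show ?thesis by (simp add: * distrib_left sum_distrib_left mult.assoc)
  qed
  have M_G: "y \<in> M" if "y \<in> ?G" for y using M_I[OF that, of "\<lambda>_. 0"] by simp
  have M_0: "0 \<in> M" by (rule M_G[OF gen_ideal_0])
  have M_sum: "(\<Sum>i\<in>I. h i) \<in> M" if "\<And>i. i \<in> I \<Longrightarrow> h i \<in> M" for I and h :: "nat \<Rightarrow> 'a mpoly"
    using that by (induction I rule: infinite_finite_induct) (auto intro: M_0 M_add)
  have f_top: "f l \<in> M" if "m \<le> l" "l < s" for l
  proof -
    have "0 + (\<Sum>k\<in>{m..<s}. (if k = l then 1 else 0) * f k) \<in> M"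
      using mconst_polys[of 1 m] by (intro M_I gen_ideal_0) auto
    then show ?thesis using that by (simp add: if_distrib[of "\<lambda>x. x * _"] cong: if_cong)
  qed
  have "\<forall>l\<in>{n..<s}. f l \<in> M" if "n \<le> m" for n
    using that
  proof (induction rule: inc_induct)
    case base
    then show ?case using f_top by simp
  next
    case (step n)
    have ns: "n < s" using step ms by simp
    let ?S = "\<Sum>l\<in>{Suc n..<s}. mconst (\<kappa> n ^ (l - n)) * var n ^ (d n - d l) * f l"
    have "mconst (\<kappa> n ^ (l - n)) * var n ^ (d n - d l) \<in> supp_in (exps m)" for l
      by (intro polys_mult mconst_polys supp_in_mono[OF forms_power[OF var_forms] exps_eq_exps]) (rule step)
    then have "?S \<in> M" using step.IH by (intro M_sum M_mult) auto
    then have "mconst (- 1) * ?S \<in> M" by (rule M_mult) (rule mconst_polys)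
    moreover have "comb s d (\<kappa> n) n f \<in> M"
      using step gen_ideal_generator[of n m "\<lambda>i. comb s d (\<kappa> i) i f" m] by (intro M_G) auto
    ultimately have "comb s d (\<kappa> n) n f + mconst (- 1) * ?S \<in> M" by (rule M_add[rotated])
    then have "f n \<in> M" by (simp add: comb_unfold[OF ns] mconst_minus)
    then show ?case using step.IH by (metis atLeastLessThan_iff le_antisym not_less_eq_eq)
  qed
  then have fM: "\<forall>l\<in>{0..<s}. f l \<in> M" by blast
  obtain q where q: "x = (\<Sum>i<s. q i * f i)" "\<forall>i<s. q i \<in> supp_in (exps m)"
    using x unfolding gen_ideal_eq by blast
  have "x \<in> M" unfolding q(1) using q(2) fM by (intro M_sum M_mult) auto
  then show ?thesis by (simp add: M_def)
qed

text \<open>The padding factor of \<open>f l\<close> has degree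
  \<open>mdeg (f i) - mdeg (f l)\<close>, exactly the extra room that the bound for the coefficient
  of \<open>f l\<close> has over the bound for \<open>q\<close>.\<close>

lemma comb_mult_in_trunc_ideal:
  assumes "i < m" "\<And>l. i \<le> l \<Longrightarrow> l < s \<Longrightarrow> mdeg (f l) \<le> mdeg (f i)"
    and q: "q \<in> supp_in (exps_le m (k - int (mdeg (f i))))"
  shows "q * comb s (\<lambda>i. mdeg (f i)) c i f \<in> trunc_ideal m s f k"
  unfolding comb_def sum_distrib_left
proof (rule trunc_ideal_sum)
  fix l assume l: "l \<in> {i..<s}"
  let ?h = "mconst (c ^ (l - i)) * var i ^ (mdeg (f i) - mdeg (f l))"
  have "?h \<in> supp_in (exps_le m (int (mdeg (f i)) - int (mdeg (f l))))"
    using comb_coeff_forms[of i m "\<lambda>i. mdeg (f i)" l] assms l by (intro supp_in_mono[OF _ exps_eq_le]) auto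
  from supp_le_mult[OF q this] have "q * ?h \<in> supp_in (exps_le m (k - int (mdeg (f l))))"
    by (simp add: algebra_simps)
  then have "(q * ?h) * f l \<in> trunc_ideal m s f k" using l by (intro trunc_ideal_term) auto
  then show "q * (?h * f l) \<in> trunc_ideal m s f k" by (simp add: mult.assoc)
qed

text \<open>A nonzero common zero of the top forms would be a common root at infinity. Taking top
  components commutes with the combinations since their coefficients are homogeneous.\<close>

lemma exists_regular_combination:
  fixes f :: "nat \<Rightarrow> 'a::alg_closed_field mpoly"
  assumes polys: "\<forall>i<s. f i \<in> polys m \<and> f i \<noteq> 0"
    and sorted: "\<forall>i j. i \<le> j \<and> j < s \<longrightarrow> mdeg (f j) \<le> mdeg (f i)"
    and no_inf: "\<forall>v\<in>proj_vecs m. (\<forall>i<s. meval (homogenize m (f i)) v = 0) \<longrightarrow> v m \<noteq> 0"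
    and ms: "m \<le> s"
  shows "\<exists>\<kappa> b \<phi>. regular_top m (\<lambda>i. comb s (\<lambda>i. mdeg (f i)) (\<kappa> i) i f) (\<lambda>i. if i < m then int (mdeg (f i)) else 1) b
     (\<Sum>i<m. int (mdeg (f i)) - 1) \<phi>"
proof -
  define d where "d i = mdeg (f i)" for i
  define F where "F i = restr (exps_eq m (int (d i))) (f i)" for i
  have f_le: "f i \<in> supp_in (exps_le m (int (d i)))" if "i < s" for i
    using polys that unfolding polys_le_eq[symmetric] by (simp add: polys_le_def d_def)
  have sorted': "d j \<le> d i" if "i \<le> j" "j < s" for i j using sorted that by (simp add: d_def)
  have F: "F i \<in> forms m (int (d i))" for i by (simp add: F_def)
  have no_zero: "\<exists>i<s. meval (F i) v \<noteq> 0" if v: "\<And>i. i \<ge> m \<Longrightarrow> v i = 0" "i < m" "v i \<noteq> 0" for v i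
  proof (rule ccontr)
    assume "\<not> ?thesis"
    then have "\<forall>i<s. meval (homogenize m (f i)) v = 0"
      using meval_homogenize_at_infinity[of _ m v] polys v(1)[of m] by (simp add: F_def d_def)
    moreover have "v \<in> proj_vecs m" using v by (auto simp: proj_vecs_def intro!: exI[of _ i])
    ultimately have "v m \<noteq> 0" using no_inf by blast
    then show False using v(1) by simp
  qed
  have "\<exists>\<kappa> \<phi>. koszul m {..<m} (\<lambda>i. if i < m then comb s d (\<kappa> i) i F else var i) (\<lambda>i. if i < m then int (d i) else 1) \<and>
    dualizing m {..<m} (\<lambda>i. if i < m then comb s d (\<kappa> i) i F else var i) (\<lambda>i. if i < m then int (d i) else 1)
      (\<Sum>i<m. int (d i) - 1) \<phi>"
  proof (rule regular_combination[OF ms F])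
    show "d j \<le> d i" if "i \<le> j" "j < s" for i j using that by (rule sorted')
    show "\<exists>i<s. meval (F i) v \<noteq> 0" if "\<And>i. i \<ge> m \<Longrightarrow> v i = 0" "i < m" "v i \<noteq> 0" for v i
      using no_zero[of v i] that by blast
  qed simp
  then obtain \<kappa> \<phi> where K: "koszul m {..<m} (\<lambda>i. if i < m then comb s d (\<kappa> i) i F else var i) (\<lambda>i. if i < m then int (d i) else 1)"
    and dual: "dualizing m {..<m} (\<lambda>i. if i < m then comb s d (\<kappa> i) i F else var i) (\<lambda>i. if i < m then int (d i) else 1)
      (\<Sum>i<m. int (d i) - 1) \<phi>"
    by blast
  have "regular_top m (\<lambda>i. comb s d (\<kappa> i) i f) (\<lambda>i. if i < m then int (d i) else 1)
      (\<lambda>i. if i < m then comb s d (\<kappa> i) i F else var i) (\<Sum>i<m. int (d i) - 1) \<phi>"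
  proof (unfold_locales)
    fix i assume i: "i < m"
    have h: "mconst (\<kappa> i ^ (l - i)) * var i ^ (d i - d l) \<in> forms m (int (d i) - int (d l))" if "l \<in> {i..<s}" for l
      using i that sorted' by (intro comb_coeff_forms) auto
    have "mconst (\<kappa> i ^ (l - i)) * var i ^ (d i - d l) * f l \<in> supp_in (exps_le m (int (d i)))" if "l \<in> {i..<s}" for l
      using supp_le_mult[OF supp_in_mono[OF h[OF that] exps_eq_le] f_le[of l]] that by simp
    then have "comb s d (\<kappa> i) i f \<in> supp_in (exps_le m (int (d i)))"
      unfolding comb_def by (rule supp_in_sum)
    then show "comb s d (\<kappa> i) i f \<in> supp_in (exps_le m (if i < m then int (d i) else 1))"
      using i by simp
    have "restr (exps_eq m (int (d i))) (mconst (\<kappa> i ^ (l - i)) * var i ^ (d i - d l) * f l) =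
        mconst (\<kappa> i ^ (l - i)) * var i ^ (d i - d l) * F l" if "l \<in> {i..<s}" for l
      using restr_forms_mult[OF h[OF that], of "int (d i)" "f l"] by (simp add: F_def mult.commute)
    then show "(if i < m then comb s d (\<kappa> i) i F else var i) =
        restr (exps_eq m (if i < m then int (d i) else 1)) (comb s d (\<kappa> i) i f)"
      using i unfolding comb_def by (simp add: restr_sum)
  qed (rule K dual)+
  then show ?thesis unfolding d_def by blast
qed

theorem theorem3p1:
  fixes m s :: nat and f :: "nat \<Rightarrow> 'a::alg_closed_field mpoly"
  assumes polys: "\<forall>i<s. f i \<in> polys m \<and> f i \<noteq> 0"
    and sorted: "\<forall>i j. i \<le> j \<and> j < s \<longrightarrow> mdeg (f j) \<le> mdeg (f i)"
    and fin: "finite (proj_common_roots m s f)"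
    and no_inf: "\<forall>v\<in>proj_vecs m. (\<forall>i<s. meval (homogenize m (f i)) v = 0) \<longrightarrow> v m \<noteq> 0"
  shows "(s = m \<longrightarrow>
            cond_star m s f (\<Sum>i<m. int (mdeg (f i)) - 1) (\<Sum>i<m. int (mdeg (f i)) - 1) \<and>
            gorenstein_quotient m (gen_ideal m s f)) \<and>
         (s > m \<longrightarrow>
            cond_star m s f ((\<Sum>i<m+1. int (mdeg (f i))) - int m)
                            ((\<Sum>i<m+1. int (mdeg (f i))) - int m))"
proof (cases "m \<le> s")
  case ms: True
  define e where "e i = (if i < m then int (mdeg (f i)) else 1)" for i
  define \<sigma> where "\<sigma> = (\<Sum>i<m. int (mdeg (f i)) - 1)"
  obtain \<kappa> b \<phi> where R: "regular_top m (\<lambda>i. comb s (\<lambda>i. mdeg (f i)) (\<kappa> i) i f) e b \<sigma> \<phi>"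
    using exists_regular_combination[OF polys sorted no_inf ms] unfolding e_def[abs_def] \<sigma>_def by blast
  define g where "g i = comb s (\<lambda>i. mdeg (f i)) (\<kappa> i) i f" for i
  interpret regular_top m g e b \<sigma> \<phi> using R unfolding g_def[abs_def] .
  \<comment> \<open>Degree control for \<open>g\<close> carries over to \<open>f\<close>, since each
    \<open>g i\<close> combines the \<open>f l\<close> within the degree of
    \<open>f i\<close>.\<close>
  have gt: "x \<in> trunc_ideal m s f k" if x: "x \<in> gen_ideal m m g" "x \<in> supp_in (exps_le m k)" for x k
  proof -
    obtain q where q: "\<forall>i<m. q i \<in> supp_in (exps_le m (k - e i))" "x = (\<Sum>i<m. q i * g i)"
      using ideal_degree_le[OF x] by blast
    have "q i * g i \<in> trunc_ideal m s f k" if "i < m" for i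
      unfolding g_def using q(1) that sorted by (intro comb_mult_in_trunc_ideal) (auto simp: e_def)
    then show ?thesis unfolding q(2) by (intro trunc_ideal_sum) auto
  qed
  have dec: "\<exists>y\<in>gen_ideal m m g. \<exists>r. (\<forall>l. r l \<in> supp_in (exps m)) \<and> x = y + (\<Sum>l\<in>{m..<s}. r l * f l)"
    if "x \<in> gen_ideal m s f" for x
    unfolding g_def[abs_def] using ms that by (rule gen_ideal_decompose)
  show ?thesis
  proof (intro conjI impI)
    assume sm: "s = m"
    \<comment> \<open>No generators are left over here, so the decomposition shows that
      \<open>f\<close> and \<open>g\<close> generate the same ideal.\<close>
    have "gen_ideal m s f \<subseteq> gen_ideal m m g" using dec by (fastforce simp: sm)
    moreover have "gen_ideal m m g \<subseteq> gen_ideal m s f"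
      unfolding g_def[abs_def] by (rule gen_ideal_comb_subset[OF ms])
    ultimately have eq: "gen_ideal m s f = gen_ideal m m g" by blast
    show "cond_star m s f (\<Sum>i<m. int (mdeg (f i)) - 1) (\<Sum>i<m. int (mdeg (f i)) - 1)"
      by (rule cond_starI) (use gt in \<open>auto simp: eq polys_le_eq\<close>)
    show "gorenstein_quotient m (gen_ideal m s f)" unfolding eq by (rule gorenstein)
  next
    assume "m < s"
    define k where "k = (\<Sum>i<m+1. int (mdeg (f i))) - int m"
    \<comment> \<open>Counting from 0, \<open>f m\<close> is the first leftover generator and has
      the largest degree among them; \<open>k\<close> adds this degree to \<sigma>.\<close>
    have k: "k = \<sigma> + int (mdeg (f m))" by (simp add: k_def \<sigma>_def sum_subtractf)
    have "x \<in> trunc_ideal m s f k" if x: "x \<in> gen_ideal m s f" "x \<in> supp_in (exps_le m k)" for x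
    proof -
      obtain y r where y: "y \<in> gen_ideal m m g" and r: "\<And>l. r l \<in> supp_in (exps m)"
        and xy: "x = y + (\<Sum>l\<in>{m..<s}. r l * f l)" using dec[OF x(1)] by blast
      \<comment> \<open>Reducing the coefficients modulo the ideal of \<open>g\<close> to degree at
        most \<sigma> brings the leftover part within degree \<open>k\<close>; the ideal of
        \<open>g\<close> absorbs the change.\<close>
      obtain r' where r': "\<And>l. r' l \<in> supp_in (exps_le m \<sigma>)" "\<And>l. r l - r' l \<in> gen_ideal m m g"
        using reduce_degree[OF r] by metis
      let ?S = "\<Sum>l\<in>{m..<s}. r' l * f l"
      have "f l * (r l - r' l) \<in> gen_ideal m m g" if "l \<in> {m..<s}" for l
        using polys that by (intro gen_ideal_mult r') (auto simp: polys_eq)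
      then have "y + (\<Sum>l\<in>{m..<s}. f l * (r l - r' l)) \<in> gen_ideal m m g"
        by (intro gen_ideal_add gen_ideal_sum y) auto
      moreover have "y + (\<Sum>l\<in>{m..<s}. f l * (r l - r' l)) = x - ?S"
        by (simp add: xy right_diff_distrib sum_subtractf mult.commute)
      ultimately have 1: "x - ?S \<in> gen_ideal m m g" by simp
      have deg: "mdeg (f l) \<le> mdeg (f m)" if "l \<in> {m..<s}" for l using sorted that by auto
      have "r' l * f l \<in> supp_in (exps_le m k)" if "l \<in> {m..<s}" for l
      proof -
        have "f l \<in> supp_in (exps_le m (int (mdeg (f l))))"
          using polys that unfolding polys_le_eq[symmetric] by (simp add: polys_le_def)
        from supp_le_mult[OF r'(1) this] show ?thesis
          by (rule supp_in_mono) (use deg[OF that] in \<open>intro exps_le_mono, simp add: k\<close>)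
      qed
      then have "x - ?S \<in> supp_in (exps_le m k)" using x(2) by (intro supp_in_diff supp_in_sum) auto
      with 1 have "x - ?S \<in> trunc_ideal m s f k" by (rule gt)
      moreover have "?S \<in> trunc_ideal m s f k"
      proof (rule trunc_ideal_sum)
        fix l assume l: "l \<in> {m..<s}"
        have "r' l \<in> supp_in (exps_le m (k - int (mdeg (f l))))"
          by (rule supp_in_mono[OF r'(1)]) (use deg[OF l] in \<open>intro exps_le_mono, simp add: k\<close>)
        then show "r' l * f l \<in> trunc_ideal m s f k" using l by (intro trunc_ideal_term) auto
      qed
      ultimately have "(x - ?S) + ?S \<in> trunc_ideal m s f k" by (rule trunc_ideal_add)
      then show ?thesis by simp
    qed
    then show "cond_star m s f ((\<Sum>i<m+1. int (mdeg (f i))) - int m) ((\<Sum>i<m+1. int (mdeg (f i))) - int m)"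
      unfolding k_def[symmetric] by (intro cond_starI) (auto simp: polys_le_eq)
  qed
\<comment> \<open>For \<open>s < m\<close> both implications have false premises.\<close>
qed auto

end
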